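(* Let the shear flow $\mathbf{u}(x,y)=(u(y),0)$ on $\mathbb{T}^2$ be $d(\nu)$-relaxation enhancing (as a shear flow), with decay rate $\delta d(\nu)$ and threshold $\nu_0$. Then there exists a constant $C\ge1$, independent of the solutions and of $\nu,\epsilon$, such that the following holds. Let $0<\nu\le\nu_0$, $\nu\le 1$, $\epsilon\in(0,1]$, and let $n_1,n_2\ge0$ be the solutions on $\mathbb{T}^2$ of $$\partial_tn_1+u(y)\partial_xn_1=\nu\Delta n_1-\epsilon n_1n_2,\qquad \partial_tn_2+u(y)\partial_xn_2=\nu\Delta n_2-\epsilon n_1n_2,$$ with nonnegative initial data $n_\alpha(0,\cdot)=n_{\alpha;0}\in C^2(\mathbb{T}^2)$, $\alpha\in\{1,2\}$, such that $\|n_{1;0}\|_{L^1}\le\|n_{2;0}\|_{L^1}$ and $\big\|\min_{\alpha\in\{1,2\}}\langle n_{\alpha;0}\rangle\big\|_{L^1_y}\neq0$. Define $$\mathcal{T}_0=\frac{1}{\delta d(\nu)}\log\left(C\left(\frac{\epsilon}{\delta d(\nu)}\sum_{\alpha}\|n_{\alpha;0}\|_{L^2_{x,y}}+1\right)\frac{\sum_\alpha\|n_{\alpha;0}\|_{L^2_{x,y}}}{\big\|\min_\alpha\langle n_{\alpha;0}\rangle\big\|_{L^1_y}}\right)$$ and $$\mathcal{T}_1=\epsilon^{-1}C\max\left\{1,\Big\|\min_{\alpha\in\{1,2\}}\langle n_{\alpha;0}\rangle\Big\|_{L^1_y}^{-1}\right\}.$$ Then $$\|n_{1;0}\|_{L^1(\mathbb{T}^2)}-\|n_1(\mathcal{T}_0+\mathcal{T}_1)\|_{L^1(\mathbb{T}^2)}\ge\frac1{12}\Big\|\min_{\alpha\in\{1,2\}}\langle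 n_{\alpha;0}\rangle\Big\|_{L^1_y}.$$
   Context: $\mathbb{T}=[-1/2,1/2]$ with endpoints identified, $\mathbb{T}^2=\mathbb{T}\times\mathbb{T}$. The $x$-average of $f$ is $\langle f\rangle(y)=\int_{\mathbb{T}}f(x,y)\,dx$. The minimum $\min_\alpha\langle n_{\alpha;0}\rangle$ is taken pointwise in $y$, and $L^1_y=L^1(\mathbb{T})$ in the variable $y$. Sums over $\alpha$ run over $\{1,2\}$. Definition ($d(\nu)$-relaxation enhancing shear flow). The shear flow $\mathbf{u}(x,y)=(u(y),0)$ is $d(\nu)$-relaxation enhancing if there exist a threshold $\nu_0(u)>0$ and constants $\delta\in(0,1)$ and $C$ depending only on the profile $u$ such that, for every $\nu\in(0,\nu_0]$, every solution $f_{\neq}$ of $\partial_tf_{\neq}+u(y)\partial_xf_{\neq}=\nu\Delta f_{\neq}$ on $\mathbb{T}^2$ with initial datum satisfying $\int_{\mathbb{T}}f_{0;\neq}(x,y)\,dx=0$ for all $y\in\mathbb{T}$ obeys $$\|f_{\neq}(t)\|_{L^2}\le C\|f_{0;\neq}\|_{L^2}e^{-\delta d(\nu)t}\qquad\text{for all }t\in[0,\infty).$$ Here the rate $d(\nu)>0$ satisfies $\lim_{\nu\to0^+}\nu/d(\nu)=0$. *)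

theory Defs
  imports "HOL-Analysis.Analysis"
begin

text \<open>
  Functions on the torus are functions on the plane that are 1-periodic in each variable, in curried
  form \<open>g x y\<close>; integrals are taken over the fundamental domain \<open>[-1/2, 1/2]\<close>, whose two endpoints
  form a null set. Time-dependent functions are written \<open>f t x y\<close> and only times \<open>t \<ge> 0\<close> matter.
\<close>

definition torus :: "real measure" where
  "torus = restrict_space lborel {-1/2..1/2}"

definition torus2 :: "(real \<times> real) measure" where
  "torus2 = torus \<Otimes>\<^sub>M torus"

definition periodic2 :: "(real \<Rightarrow> real \<Rightarrow> real) \<Rightarrow> bool" where
  "periodic2 g \<longleftrightarrow> (\<forall>x y. g (x + 1) y = g x y \<and> g x (y + 1) = g x y)"

definition L1_norm_y :: "(real \<Rightarrow> real) \<Rightarrow> real" where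
  "L1_norm_y h = (LINT y|torus. \<bar>h y\<bar>)"

definition L1_norm :: "(real \<Rightarrow> real \<Rightarrow> real) \<Rightarrow> real" where
  "L1_norm g = (LINT (x, y)|torus2. \<bar>g x y\<bar>)"

definition L2_norm :: "(real \<Rightarrow> real \<Rightarrow> real) \<Rightarrow> real" where
  "L2_norm g = sqrt (LINT (x, y)|torus2. (g x y)\<^sup>2)"

definition in_L2 :: "(real \<Rightarrow> real \<Rightarrow> real) \<Rightarrow> bool" where
  "in_L2 g \<longleftrightarrow> case_prod g \<in> borel_measurable torus2 \<and> integrable torus2 (\<lambda>(x, y). (g x y)\<^sup>2)"

definition x_average :: "(real \<Rightarrow> real \<Rightarrow> real) \<Rightarrow> real \<Rightarrow> real" where
  "x_average g y = (LINT x|torus. g x y)"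

definition Dx :: "(real \<Rightarrow> real \<Rightarrow> real) \<Rightarrow> real \<Rightarrow> real \<Rightarrow> real" where
  "Dx g x y = deriv (\<lambda>s. g s y) x"

definition Dy :: "(real \<Rightarrow> real \<Rightarrow> real) \<Rightarrow> real \<Rightarrow> real \<Rightarrow> real" where
  "Dy g x y = deriv (\<lambda>s. g x s) y"

definition Dt :: "(real \<Rightarrow> real \<Rightarrow> real \<Rightarrow> real) \<Rightarrow> real \<Rightarrow> real \<Rightarrow> real \<Rightarrow> real" where
  "Dt f t x y = deriv (\<lambda>s. f s x y) t"

definition Laplacian :: "(real \<Rightarrow> real \<Rightarrow> real) \<Rightarrow> real \<Rightarrow> real \<Rightarrow> real" where
  "Laplacian g x y = Dx (Dx g) x y + Dy (Dy g) x y"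

definition C1 :: "(real \<Rightarrow> real \<Rightarrow> real) \<Rightarrow> bool" where
  "C1 g \<longleftrightarrow>
    (\<forall>x y. (\<lambda>s. g s y) field_differentiable (at x) \<and> (\<lambda>s. g x s) field_differentiable (at y)) \<and>
    continuous_on UNIV (case_prod (Dx g)) \<and> continuous_on UNIV (case_prod (Dy g))"

definition C2_torus :: "(real \<Rightarrow> real \<Rightarrow> real) \<Rightarrow> bool" where
  "C2_torus g \<longleftrightarrow> periodic2 g \<and> C1 g \<and> C1 (Dx g) \<and> C1 (Dy g)"

definition continuous_pos_time :: "(real \<Rightarrow> real \<Rightarrow> real \<Rightarrow> real) \<Rightarrow> bool" where
  "continuous_pos_time f \<longleftrightarrow> continuous_on {(t, x, y). 0 < t} (\<lambda>(t, x, y). f t x y)"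

text \<open>Once continuously differentiable in time and twice in space, jointly, for \<open>t > 0\<close>.\<close>

definition C12_torus :: "(real \<Rightarrow> real \<Rightarrow> real \<Rightarrow> real) \<Rightarrow> bool" where
  "C12_torus f \<longleftrightarrow>
    (\<forall>t>0. C2_torus (f t)) \<and>
    (\<forall>t>0. \<forall>x y. (\<lambda>s. f s x y) field_differentiable (at t)) \<and>
    continuous_pos_time f \<and>
    continuous_pos_time (Dt f) \<and>
    continuous_pos_time (\<lambda>t. Dx (f t)) \<and>
    continuous_pos_time (\<lambda>t. Dy (f t)) \<and>
    continuous_pos_time (\<lambda>t. Dx (Dx (f t))) \<and>
    continuous_pos_time (\<lambda>t. Dx (Dy (f t))) \<and>
    continuous_pos_time (\<lambda>t. Dy (Dx (f t))) \<and>
    continuous_pos_time (\<lambda>t. Dy (Dy (f t)))"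

text \<open>
  Solutions of \<open>\<partial>\<^sub>t f + u(y) \<partial>\<^sub>x f = \<nu> \<Delta>f + F\<close> on the torus: classical for \<open>t > 0\<close>, with initial datum
  \<open>f 0\<close> in \<open>L\<^sup>2\<close> attained in the \<open>L\<^sup>2\<close> sense, so that parabolic smoothing of rough data is covered.
\<close>

definition shear_solution ::
  "(real \<Rightarrow> real) \<Rightarrow> real \<Rightarrow> (real \<Rightarrow> real \<Rightarrow> real \<Rightarrow> real) \<Rightarrow> (real \<Rightarrow> real \<Rightarrow> real \<Rightarrow> real) \<Rightarrow> bool" where
  "shear_solution u \<nu> F f \<longleftrightarrow>
    periodic2 (f 0) \<and> in_L2 (f 0) \<and> C12_torus f \<and>
    (\<forall>t>0. \<forall>x y. Dt f t x y + u y * Dx (f t) x y = \<nu> * Laplacian (f t) x y + F t x y) \<and>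
    ((\<lambda>t. L2_norm (\<lambda>x y. f t x y - f 0 x y)) \<longlongrightarrow> 0) (at_right 0)"

text \<open>
  The shear flow \<open>(u(y), 0)\<close> is \<open>d(\<nu>)\<close>-relaxation enhancing with decay rate \<open>\<delta> d(\<nu>)\<close> and threshold
  \<open>\<nu>\<^sub>0\<close>. These witnesses are kept as parameters because the reaction time depends on them.
\<close>

definition relaxation_enhancing ::
  "(real \<Rightarrow> real) \<Rightarrow> (real \<Rightarrow> real) \<Rightarrow> real \<Rightarrow> real \<Rightarrow> bool" where
  "relaxation_enhancing u d \<delta> \<nu>\<^sub>0 \<longleftrightarrow>
    0 < \<nu>\<^sub>0 \<and> \<delta> \<in> {0<..<1} \<and>
    (\<forall>\<nu>\<in>{0<..\<nu>\<^sub>0}. 0 < d \<nu>) \<and> ((\<lambda>\<nu>. \<nu> / d \<nu>) \<longlongrightarrow> 0) (at_right 0) \<and>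
    (\<exists>C. \<forall>\<nu>\<in>{0<..\<nu>\<^sub>0}. \<forall>f.
      shear_solution u \<nu> (\<lambda>t x y. 0) f \<longrightarrow> (\<forall>y. x_average (f 0) y = 0) \<longrightarrow>
      (\<forall>t\<ge>0. L2_norm (f t) \<le> C * L2_norm (f 0) * exp (- \<delta> * d \<nu> * t)))"

definition min_average_norm :: "(real \<Rightarrow> real \<Rightarrow> real) \<Rightarrow> (real \<Rightarrow> real \<Rightarrow> real) \<Rightarrow> real" where
  "min_average_norm g h = L1_norm_y (\<lambda>y. min (x_average g y) (x_average h y))"

end

theory Submission
  imports Defs
begin

text \<open>
  The difference \<open>w = n\<^sub>1 - n\<^sub>2\<close> solves the passive scalar equation exactly. Its fluctuation
  \<open>w - \<langle>w\<rangle>\<close> is again a passive scalar, with vanishing averages, and so decays at the enhanced rate,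
  while \<open>\<langle>w\<rangle>\<close> solves the heat equation in \<open>y\<close>, which contracts \<open>L\<^sup>1\<close>. Hence, for \<open>t \<ge> \<T>\<^sub>0\<close>, the norm
  \<open>\<parallel>w(t)\<parallel>\<close> in \<open>L\<^sup>1\<close> exceeds that of \<open>\<langle>w(0)\<rangle>\<close> by at most \<open>M/2\<close>, where \<open>M\<close> is the norm of
  \<open>min \<langle>n\<^sub>\<alpha>(0)\<rangle>\<close>. Since \<open>2 min n\<^sub>\<alpha> = n\<^sub>1 + n\<^sub>2 - \<bar>w\<bar>\<close> and both species lose the same mass, the
  integral of \<open>min n\<^sub>\<alpha>(t)\<close> stays above \<open>M/2\<close> as long as the loss is below \<open>M/12\<close>. By Jensen the reaction rate
  \<open>\<epsilon> \<integral> n\<^sub>1 n\<^sub>2 \<ge> \<epsilon> \<integral> (min n\<^sub>\<alpha>)\<^sup>2\<close> is then at least \<open>\<epsilon> M\<^sup>2/4\<close>, which over a time of order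
  \<open>1/(\<epsilon> M)\<close> contradicts the smallness of the loss.
\<close>

section \<open>Integration on the torus\<close>

lemma space_torus: "space torus = {-1/2..1/2}"
  by (simp add: torus_def space_restrict_space)

lemma emeasure_torus: "emeasure torus (space torus) = 1"
  unfolding space_torus by (simp add: torus_def emeasure_restrict_space)

interpretation torus: finite_measure torus
  by (rule finite_measureI) (simp add: emeasure_torus)

interpretation torus_pair: pair_sigma_finite torus torus
  by standard

interpretation torus2: finite_measure torus2
  unfolding torus2_def
  by (rule finite_measure_pair_measure; rule torus.finite_measure_axioms)

lemma measure_torus [simp]: "measure torus (space torus) = 1"
  by (simp add: measure_def emeasure_torus)

lemma measure_torus2 [simp]: "measure torus2 (space torus2) = 1"
  using torus.emeasure_pair_measure_Times[of "space torus" torus "space torus"]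
  by (simp add: measure_def torus2_def space_pair_measure emeasure_torus)

text \<open>Agreement with the gauge integral over the compact interval gives access to the
  fundamental theorem of calculus and to the Leibniz rule.\<close>

lemma continuous_integral_torus:
  fixes g :: "real \<Rightarrow> real"
  assumes "continuous_on UNIV g"
  shows integrable_torus: "integrable torus g"
    and LINT_torus_eq_integral: "(LINT x|torus. g x) = integral {-1/2..1/2} g"
proof -
  have "set_integrable lborel {-1/2..1/2} g"
    by (rule borel_integrable_atLeastAtMost') (use assms continuous_on_subset in blast)
  then show "integrable torus g" "(LINT x|torus. g x) = integral {-1/2..1/2} g"
    using set_borel_integral_eq_integral(2)[of "{-1/2..1/2}" g]
    by (simp_all add: torus_def integrable_restrict_space integral_restrict_space
        set_integrable_def set_lebesgue_integral_def)
qed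

text \<open>The boundary terms at the two ends of the period cancel. Integration by parts takes this
  form below: the derivative of a periodic function has integral zero.\<close>

lemma LINT_torus_periodic_derivative:
  fixes F f :: "real \<Rightarrow> real"
  assumes "\<And>x. (F has_real_derivative f x) (at x)" and "continuous_on UNIV f"
    and "\<And>x. F (x + 1) = F x"
  shows "(LINT x|torus. f x) = 0"
proof -
  have "(f has_integral F (1/2) - F (-1/2)) {-1/2..1/2}"
    using assms(1)
    by (intro fundamental_theorem_of_calculus)
      (auto simp: has_real_derivative_iff_has_vector_derivative[symmetric]
        intro: has_field_derivative_at_within)
  moreover have "F (1/2) = F (-1/2)"
    using assms(3)[of "-1/2"] by simp
  ultimately show ?thesis
    using LINT_torus_eq_integral[OF assms(2)] by (simp add: integral_unique)
qed

lemma continuous_on_LINT_torus: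
  fixes g :: "'a::topological_space \<Rightarrow> real \<Rightarrow> real"
  assumes "continuous_on (U \<times> UNIV) (\<lambda>(p, x). g p x)"
  shows "continuous_on U (\<lambda>p. LINT x|torus. g p x)"
proof -
  have "continuous_on UNIV (g p)" if "p \<in> U" for p
    by (rule continuous_on_compose2[OF assms, of UNIV "\<lambda>x. (p, x)", simplified])
      (use that in \<open>auto intro!: continuous_intros\<close>)
  then have "(LINT x|torus. g p x) = integral (cbox (-1/2) (1/2)) (g p)" if "p \<in> U" for p
    using that LINT_torus_eq_integral by simp
  moreover have "continuous_on U (\<lambda>p. integral (cbox (-1/2) (1/2)) (g p))"
    by (intro integral_continuous_on_param continuous_on_subset[OF assms]) auto
  ultimately show ?thesis
    by (simp cong: continuous_on_cong)
qed

text \<open>This is the Leibniz rule over a compact interval. The open convex set \<open>U\<close>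
  is the whole line for a spatial parameter and \<open>{0<..}\<close> for time, where solutions are
  classical.\<close>

lemma DERIV_LINT_torus:
  fixes f f' :: "real \<Rightarrow> real \<Rightarrow> real"
  assumes deriv: "\<And>s x. s \<in> U \<Longrightarrow> ((\<lambda>s. f s x) has_real_derivative f' s x) (at s)"
    and cont: "\<And>s. s \<in> U \<Longrightarrow> continuous_on UNIV (f s)"
    and cont': "continuous_on (U \<times> UNIV) (\<lambda>(s, x). f' s x)"
    and U: "t \<in> U" "open U" "convex U"
  shows "((\<lambda>s. LINT x|torus. f s x) has_real_derivative (LINT x|torus. f' t x)) (at t)"
proof -
  have "continuous_on UNIV (f' t)"
    by (rule continuous_on_compose2[OF cont', of UNIV "\<lambda>x. (t, x)", simplified])
      (use U in \<open>auto intro!: continuous_intros\<close>)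
  then have eq: "(LINT x|torus. f' t x) = integral (cbox (-1/2) (1/2)) (f' t)"
    using LINT_torus_eq_integral by simp
  have "((\<lambda>s. integral (cbox (-1/2) (1/2)) (f s)) has_real_derivative
      integral (cbox (-1/2) (1/2)) (f' t)) (at t within U)"
    using U cont
    by (intro leibniz_rule_field_derivative)
      (auto intro!: has_field_derivative_at_within[OF deriv] integrable_continuous_real
         intro: continuous_on_subset continuous_on_subset[OF cont'])
  then have "((\<lambda>s. integral (cbox (-1/2) (1/2)) (f s)) has_real_derivative
      integral (cbox (-1/2) (1/2)) (f' t)) (at t)"
    using U at_within_open by metis
  then show ?thesis
    unfolding eq
    by (rule has_field_derivative_transform_within_open[OF _ U(2,1)])
      (use cont LINT_torus_eq_integral in simp)
qed

lemma measurable_torus2: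
  assumes "continuous_on UNIV (case_prod g)"
  shows "case_prod g \<in> borel_measurable torus2"
proof -
  \<comment> \<open>The factors of \<open>torus2\<close> carry restricted sigma-algebras, while
    continuity gives Borel measurability on the whole plane; the identity map connects the
    two.\<close>
  have "(\<lambda>p. p) \<in> measurable torus2 (borel \<Otimes>\<^sub>M borel)"
    unfolding torus2_def torus_def
    by (intro measurable_pair) (auto simp: comp_def
        intro!: measurable_compose[OF measurable_fst] measurable_compose[OF measurable_snd]
          measurable_restrict_space1)
  moreover have "case_prod g \<in> borel_measurable (borel \<Otimes>\<^sub>M borel)"
    unfolding borel_prod using assms by (rule borel_measurable_continuous_onI)
  ultimately show ?thesis
    by (rule measurable_compose)
qed

lemma space_torus2: "space torus2 = {-1/2..1/2} \<times> {-1/2..1/2}"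
  by (simp add: torus2_def space_pair_measure space_torus)

lemma integrable_torus2:
  fixes g :: "real \<Rightarrow> real \<Rightarrow> real"
  assumes "continuous_on UNIV (case_prod g)"
  shows "integrable torus2 (\<lambda>(x, y). g x y)"
proof -
  have "compact (space torus2)"
    by (auto simp: space_torus2 intro: compact_Times)
  then have "bounded (case_prod g ` space torus2)"
    by (intro compact_imp_bounded compact_continuous_image continuous_on_subset[OF assms]) auto
  then obtain B where "\<forall>p\<in>space torus2. norm (case_prod g p) \<le> B"
    unfolding bounded_iff by blast
  then show ?thesis
    by (intro torus2.integrable_const_bound[where B = B] measurable_torus2 assms AE_I2) auto
qed

text \<open>Fubini with \<open>x\<close> integrated first, so that the inner integral is
  \<open>x_average\<close>.\<close>

lemma LINT_torus2:
  fixes g :: "real \<Rightarrow> real \<Rightarrow> real"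
  assumes "integrable torus2 (\<lambda>(x, y). g x y)"
  shows "(LINT (x, y)|torus2. g x y) = (LINT y|torus. x_average g y)"
  using torus_pair.integral_snd[of g] assms by (simp add: torus2_def x_average_def)

lemma continuous_x_average:
  assumes "continuous_on UNIV (case_prod g)"
  shows "continuous_on UNIV (x_average g)"
proof -
  have "continuous_on UNIV (\<lambda>(y, x). case_prod g (x, y))"
    unfolding case_prod_unfold
    by (rule continuous_on_compose2[OF assms[unfolded case_prod_unfold]])
      (auto intro!: continuous_intros)
  then show ?thesis
    unfolding x_average_def by (intro continuous_on_LINT_torus) simp
qed

lemma continuous_slices:
  assumes "continuous_on UNIV (case_prod g)"
  shows "continuous_on UNIV (\<lambda>x. g x y)" "continuous_on UNIV (g x)"
proof -
  have "continuous_on UNIV (\<lambda>x. case_prod g (x, y))" "continuous_on UNIV (\<lambda>y. case_prod g (x, y))"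
    by (rule continuous_on_compose2[OF assms]; intro continuous_intros subset_UNIV)+
  then show "continuous_on UNIV (\<lambda>x. g x y)" "continuous_on UNIV (g x)"
    by simp_all
qed

text \<open>Jensen's inequality for the square on a probability space, obtained from the
  nonnegativity of the variance.\<close>

lemma square_integral_le:
  fixes f :: "'a \<Rightarrow> real"
  assumes "finite_measure M" "measure M (space M) = 1"
    and "f \<in> borel_measurable M" and "integrable M (\<lambda>z. (f z)\<^sup>2)"
  shows "integrable M f" "(LINT z|M. f z)\<^sup>2 \<le> (LINT z|M. (f z)\<^sup>2)"
proof -
  interpret finite_measure M by fact
  show int: "integrable M f"
    using assms(3,4) by (rule square_integrable_imp_integrable)
  define a where "a = (LINT z|M. f z)"
  have "0 \<le> (LINT z|M. (f z - a)\<^sup>2)"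
    by simp
  also have "\<dots> = (LINT z|M. (f z)\<^sup>2 - 2 * a * f z + a\<^sup>2)"
    by (simp add: power2_diff algebra_simps)
  also have "\<dots> = (LINT z|M. (f z)\<^sup>2) - a\<^sup>2"
    using int assms(2,4) by (simp add: a_def[symmetric] power2_eq_square)
  finally show "(LINT z|M. f z)\<^sup>2 \<le> (LINT z|M. (f z)\<^sup>2)"
    by (simp add: a_def)
qed

section \<open>Comparison of the L1 and L2 norms\<close>

lemma integrable_in_L2: "in_L2 g \<Longrightarrow> integrable torus2 (\<lambda>(x, y). g x y)"
  unfolding in_L2_def
  by (rule square_integral_le(1)[OF torus2.finite_measure_axioms measure_torus2])
    (simp_all add: case_prod_unfold)

lemma L1_norm_le_L2_norm:
  assumes "in_L2 g"
  shows "L1_norm g \<le> L2_norm g"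
  unfolding L1_norm_def L2_norm_def
proof (rule real_le_rsqrt)
  have "(\<lambda>p. \<bar>case_prod g p\<bar>) \<in> borel_measurable torus2"
    "integrable torus2 (\<lambda>p. \<bar>case_prod g p\<bar>\<^sup>2)"
    using assms by (auto simp: in_L2_def case_prod_unfold)
  then have "(LINT p|torus2. \<bar>case_prod g p\<bar>)\<^sup>2 \<le> (LINT p|torus2. \<bar>case_prod g p\<bar>\<^sup>2)"
    by (rule square_integral_le(2)[OF torus2.finite_measure_axioms measure_torus2])
  then show "(LINT (x, y)|torus2. \<bar>g x y\<bar>)\<^sup>2 \<le> (LINT (x, y)|torus2. (g x y)\<^sup>2)"
    by (simp add: case_prod_unfold)
qed

lemma L2_norm_nonneg [simp]: "0 \<le> L2_norm g"
  by (simp add: L2_norm_def case_prod_unfold)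

lemma in_L2_continuous:
  assumes "continuous_on UNIV (case_prod g)"
  shows "in_L2 g"
proof -
  have "continuous_on UNIV (\<lambda>(x, y). (g x y)\<^sup>2)"
    using assms by (auto simp: case_prod_unfold intro!: continuous_intros)
  then show ?thesis
    using assms measurable_torus2 integrable_torus2 by (simp add: in_L2_def)
qed

text \<open>The pointwise bound of the squared difference by twice the sum of the squares, together
  with subadditivity of the square root, replaces Minkowski's inequality. The factor
  \<open>sqrt 2\<close> is harmless, since the estimate serves only to show that norms tend to
  zero.\<close>

lemma in_L2_diff:
  assumes "in_L2 g" "in_L2 h"
  shows "in_L2 (\<lambda>x y. g x y - h x y)"
    and "L2_norm (\<lambda>x y. g x y - h x y) \<le> sqrt 2 * (L2_norm g + L2_norm h)"
proof -
  define G H where "G = case_prod g" and "H = case_prod h"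
  have GH: "G \<in> borel_measurable torus2" "H \<in> borel_measurable torus2"
    "integrable torus2 (\<lambda>p. (G p)\<^sup>2)" "integrable torus2 (\<lambda>p. (H p)\<^sup>2)"
    using assms by (auto simp: in_L2_def case_prod_unfold G_def H_def)
  have le: "(G p - H p)\<^sup>2 \<le> 2 * (G p)\<^sup>2 + 2 * (H p)\<^sup>2" for p
    using zero_le_power2[of "G p + H p"] by (simp add: power2_eq_square algebra_simps)
  have int: "integrable torus2 (\<lambda>p. (G p - H p)\<^sup>2)"
    by (rule Bochner_Integration.integrable_bound[where f = "\<lambda>p. 2 * (G p)\<^sup>2 + 2 * (H p)\<^sup>2"])
      (use GH le in auto)
  then show "in_L2 (\<lambda>x y. g x y - h x y)"
    using GH by (simp add: in_L2_def case_prod_unfold G_def H_def)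
  have "(LINT p|torus2. (G p - H p)\<^sup>2) \<le> (LINT p|torus2. 2 * (G p)\<^sup>2 + 2 * (H p)\<^sup>2)"
    using int GH le by (intro integral_mono) auto
  also have "\<dots> = 2 * ((LINT p|torus2. (G p)\<^sup>2) + (LINT p|torus2. (H p)\<^sup>2))"
    using GH by simp
  finally have "sqrt (LINT p|torus2. (G p - H p)\<^sup>2) \<le>
      sqrt 2 * sqrt ((LINT p|torus2. (G p)\<^sup>2) + (LINT p|torus2. (H p)\<^sup>2))"
    by (simp add: real_sqrt_mult[symmetric])
  also have "\<dots> \<le> sqrt 2 * (sqrt (LINT p|torus2. (G p)\<^sup>2) + sqrt (LINT p|torus2. (H p)\<^sup>2))"
    by (intro mult_left_mono sqrt_add_le_add_sqrt) auto
  finally show "L2_norm (\<lambda>x y. g x y - h x y) \<le> sqrt 2 * (L2_norm g + L2_norm h)"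
    by (simp add: L2_norm_def case_prod_unfold G_def H_def)
qed

text \<open>For each \<open>y\<close> the integral of the square of \<open>g\<close> splits into the
  square of the average and the variance around it. Both parts are nonnegative, so the average and
  the fluctuation are each dominated by \<open>g\<close>; they are the two complementary orthogonal
  projections.\<close>

lemma L2_norm_x_average:
  assumes g: "continuous_on UNIV (case_prod g)"
  shows "L2_norm (\<lambda>x y. x_average g y) \<le> L2_norm g"
    and "L2_norm (\<lambda>x y. g x y - x_average g y) \<le> L2_norm g"
proof -
  note avg = continuous_x_average[OF g]
  note avg_cont = continuous_on_compose2[OF avg continuous_on_snd[OF continuous_on_id], simplified]
  have sq: "continuous_on UNIV (\<lambda>(x, y). (g x y)\<^sup>2)"
    "continuous_on UNIV (\<lambda>(x, y). (x_average g y)\<^sup>2)"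
    "continuous_on UNIV (\<lambda>(x, y). (g x y - x_average g y)\<^sup>2)"
    using g by (auto simp: case_prod_unfold intro!: continuous_intros avg_cont)
  have 1: "integrable torus (x_average (\<lambda>x y. (g x y)\<^sup>2))"
    by (intro integrable_torus continuous_x_average) (rule sq(1))
  have 2: "integrable torus (\<lambda>y. (x_average g y)\<^sup>2)"
    by (intro integrable_torus continuous_intros avg)
  have eq: "x_average (\<lambda>x y. (g x y - x_average g y)\<^sup>2) y =
      x_average (\<lambda>x y. (g x y)\<^sup>2) y - (x_average g y)\<^sup>2" for y
  proof -
    have "(LINT x|torus. (g x y - a)\<^sup>2) = (LINT x|torus. (g x y)\<^sup>2 - 2 * a * g x y + a\<^sup>2)" for a
      by (simp add: power2_diff algebra_simps)
    moreover have "integrable torus (\<lambda>x. g x y)" "integrable torus (\<lambda>x. (g x y)\<^sup>2)"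
      using continuous_slices[OF g] by (auto intro!: integrable_torus continuous_intros)
    ultimately show ?thesis
      unfolding x_average_def by (simp add: power2_eq_square)
  qed
  have nonneg: "0 \<le> x_average (\<lambda>x y. (g x y - x_average g y)\<^sup>2) y" for y
    by (simp add: x_average_def)
  have avg_le: "(x_average g y)\<^sup>2 \<le> x_average (\<lambda>x y. (g x y)\<^sup>2) y" for y
    using nonneg eq by simp
  have "(LINT y|torus. (x_average g y)\<^sup>2) \<le> (LINT y|torus. x_average (\<lambda>x y. (g x y)\<^sup>2) y)"
    using 1 2 avg_le by (intro integral_mono) auto
  moreover have "x_average (\<lambda>x y. (x_average g y)\<^sup>2) = (\<lambda>y. (x_average g y)\<^sup>2)"
    by (simp add: x_average_def fun_eq_iff)
  ultimately show "L2_norm (\<lambda>x y. x_average g y) \<le> L2_norm g"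
    using LINT_torus2[OF integrable_torus2[OF sq(1)]] LINT_torus2[OF integrable_torus2[OF sq(2)]]
    by (simp add: L2_norm_def)
  have "(LINT y|torus. x_average (\<lambda>x y. (g x y - x_average g y)\<^sup>2) y) \<le>
      (LINT y|torus. x_average (\<lambda>x y. (g x y)\<^sup>2) y)"
    using 1 2 eq by (intro integral_mono) auto
  then show "L2_norm (\<lambda>x y. g x y - x_average g y) \<le> L2_norm g"
    using LINT_torus2[OF integrable_torus2[OF sq(1)]] LINT_torus2[OF integrable_torus2[OF sq(3)]]
    by (simp add: L2_norm_def)
qed

section \<open>Averages, minima and L1 norms\<close>

lemma x_average_diff:
  assumes "continuous_on UNIV (case_prod g)" "continuous_on UNIV (case_prod h)"
  shows "x_average (\<lambda>x y. g x y - h x y) y = x_average g y - x_average h y"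
  using assms[THEN continuous_slices(1), THEN integrable_torus] by (simp add: x_average_def)

lemma continuous_x_average_plane:
  assumes "continuous_on UNIV (case_prod g)"
  shows "continuous_on UNIV (case_prod (\<lambda>x. x_average g))"
  using continuous_on_compose2[OF continuous_x_average[OF assms], of UNIV snd]
  by (simp add: case_prod_unfold continuous_intros)

lemma L1_norm_triangle:
  assumes "integrable torus2 (\<lambda>(x, y). g x y)" "integrable torus2 (\<lambda>(x, y). h x y)"
  shows "L1_norm g \<le> L1_norm h + L1_norm (\<lambda>x y. g x y - h x y)"
proof -
  have "L1_norm g \<le> (LINT p|torus2. \<bar>case_prod h p\<bar> + \<bar>case_prod g p - case_prod h p\<bar>)"
    using assms unfolding L1_norm_def case_prod_unfold by (intro integral_mono) auto
  then show ?thesis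
    using assms by (simp add: L1_norm_def case_prod_unfold)
qed

lemma L1_norm_minus_commute: "L1_norm (\<lambda>x y. g x y - h x y) = L1_norm (\<lambda>x y. h x y - g x y)"
  by (simp add: L1_norm_def abs_minus_commute)

lemma L1_norm_function_of_y: "L1_norm (\<lambda>x. h) = L1_norm_y h" if "continuous_on UNIV h"
proof -
  have "continuous_on UNIV (\<lambda>(x::real, y). \<bar>h y\<bar>)"
    unfolding case_prod_unfold
    by (intro continuous_on_rabs continuous_on_compose2[OF that] continuous_intros) auto
  from LINT_torus2[OF integrable_torus2[OF this]] show ?thesis
    by (simp add: L1_norm_def L1_norm_y_def x_average_def)
qed

text \<open>Integrates \<open>2 * min a b = a + b - \<bar>a - b\<bar>\<close> with \<open>a\<close>
  and \<open>b\<close> the two averages. It turns the overlap of the initial averages into the L1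
  norm of the averaged difference, which the heat flow controls.\<close>

lemma min_average_norm_eq:
  assumes g: "continuous_on UNIV (case_prod g)" and h: "continuous_on UNIV (case_prod h)"
    and nonneg: "\<And>x y. 0 \<le> g x y" "\<And>x y. 0 \<le> h x y"
  shows "2 * min_average_norm g h =
    L1_norm g + L1_norm h - L1_norm_y (x_average (\<lambda>x y. g x y - h x y))"
proof -
  have int: "integrable torus (x_average g)" "integrable torus (x_average h)"
    using g h by (auto intro!: integrable_torus continuous_x_average)
  have "2 * \<bar>min (x_average g y) (x_average h y)\<bar> =
      x_average g y + x_average h y - \<bar>x_average g y - x_average h y\<bar>" for y
  proof -
    have "0 \<le> x_average g y" "0 \<le> x_average h y"
      using nonneg by (simp_all add: x_average_def)
    then show ?thesis
      by (simp add: min_def)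
  qed
  then have "2 * min_average_norm g h =
      (LINT y|torus. x_average g y + x_average h y - \<bar>x_average g y - x_average h y\<bar>)"
    by (simp add: min_average_norm_def L1_norm_y_def flip: Bochner_Integration.integral_mult_right_zero)
  moreover have "L1_norm g = (LINT y|torus. x_average g y)" "L1_norm h = (LINT y|torus. x_average h y)"
    using nonneg g h by (simp_all add: L1_norm_def LINT_torus2 integrable_torus2)
  ultimately show ?thesis
    using int by (simp add: L1_norm_y_def x_average_diff[OF g h])
qed

text \<open>Nonnegativity makes the cross term favourable, so the constant is 1 instead of the
  \<open>sqrt 2\<close> of \<open>in_L2_diff\<close>. This lets the fluctuation error come out as
  \<open>M / 2\<close> in the final estimate.\<close>

lemma L2_norm_diff_nonneg_le:
  assumes "in_L2 g" "in_L2 h" and nonneg: "\<And>x y. 0 \<le> g x y" "\<And>x y. 0 \<le> h x y"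
  shows "L2_norm (\<lambda>x y. g x y - h x y) \<le> L2_norm g + L2_norm h"
proof -
  define G H where "G = case_prod g" and "H = case_prod h"
  have int: "integrable torus2 (\<lambda>p. (G p)\<^sup>2)" "integrable torus2 (\<lambda>p. (H p)\<^sup>2)"
    "integrable torus2 (\<lambda>p. (G p - H p)\<^sup>2)"
    using assms(1,2) in_L2_diff(1)[OF assms(1,2)]
    by (simp_all add: in_L2_def case_prod_unfold G_def H_def)
  have "(G p - H p)\<^sup>2 \<le> (G p)\<^sup>2 + (H p)\<^sup>2" for p
    using nonneg by (simp add: G_def H_def case_prod_unfold power2_diff)
  then have "(LINT p|torus2. (G p - H p)\<^sup>2) \<le> (LINT p|torus2. (G p)\<^sup>2 + (H p)\<^sup>2)"
    using int by (intro integral_mono) auto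
  also have "\<dots> = (LINT p|torus2. (G p)\<^sup>2) + (LINT p|torus2. (H p)\<^sup>2)"
    using int by simp
  finally have "sqrt (LINT p|torus2. (G p - H p)\<^sup>2) \<le>
      sqrt ((LINT p|torus2. (G p)\<^sup>2) + (LINT p|torus2. (H p)\<^sup>2))"
    by (rule real_sqrt_le_mono)
  also have "\<dots> \<le> sqrt (LINT p|torus2. (G p)\<^sup>2) + sqrt (LINT p|torus2. (H p)\<^sup>2)"
    by (rule sqrt_add_le_add_sqrt) simp_all
  finally show ?thesis
    by (simp add: L2_norm_def case_prod_unfold G_def H_def)
qed

section \<open>Derivatives and the average in \<open>x\<close>\<close>

lemma C1_has_derivative:
  assumes "C1 g"
  shows "((\<lambda>s. g s y) has_real_derivative Dx g x y) (at x)"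
    and "((\<lambda>s. g x s) has_real_derivative Dy g x y) (at y)"
  using assms by (auto simp: C1_def Dx_def Dy_def DERIV_deriv_iff_field_differentiable)

text \<open>\<open>C1\<close> speaks of partial derivatives only. Their joint continuity yields
  total differentiability, and joint continuity of \<open>g\<close> follows from that.\<close>

lemma C1_continuous:
  assumes "C1 g"
  shows "continuous_on UNIV (case_prod g)"
proof -
  have "((\<lambda>(x, y). g x y) has_derivative
      (\<lambda>(tx, ty). (*) (Dx g x y) tx + blinfun_apply (blinfun_mult_right (Dy g x y)) ty))
      (at (x, y) within UNIV \<times> UNIV)" for x y
  proof (rule has_derivative_partialsI)
    show "((\<lambda>s. g s y) has_derivative (*) (Dx g x y)) (at x within UNIV)"
      using C1_has_derivative(1)[OF assms] by (simp add: has_field_derivative_def)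
    show "((\<lambda>s. g x s) has_derivative blinfun_apply (blinfun_mult_right (Dy g x y))) (at y within UNIV)"
      for x y
      using C1_has_derivative(2)[OF assms] by (simp add: has_field_derivative_def)
    \<comment> \<open>The criterion asks for continuity of the partial derivative as a map into the
      bounded linear operators; multiplication by a scalar depends on the scalar
      continuously.\<close>
    have "isCont (case_prod (Dy g)) (x, y)"
      using assms by (simp add: C1_def continuous_on_eq_continuous_at)
    then have "isCont (\<lambda>p. blinfun_mult_right (case_prod (Dy g) p)) (x, y)"
      by (rule bounded_linear.isCont[OF bounded_linear_blinfun_mult_right])
    then show "continuous (at (x, y) within UNIV \<times> UNIV) (\<lambda>(x, y). blinfun_mult_right (Dy g x y))"
      by (simp add: case_prod_unfold)
  qed auto
  then have "isCont (case_prod g) (x, y)" for x y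
    using has_derivative_continuous by fastforce
  then show ?thesis
    by (simp add: continuous_on_eq_continuous_at)
qed

lemma C1_I:
  assumes "\<And>x y. ((\<lambda>s. g s y) has_real_derivative gx x y) (at x)"
    and "\<And>x y. ((\<lambda>s. g x s) has_real_derivative gy x y) (at y)"
    and "continuous_on UNIV (case_prod gx)" "continuous_on UNIV (case_prod gy)"
  shows "C1 g" "Dx g = gx" "Dy g = gy"
proof -
  show *: "Dx g = gx" "Dy g = gy"
    using assms(1,2) by (simp_all add: Dx_def Dy_def fun_eq_iff DERIV_imp_deriv)
  show "C1 g"
    unfolding C1_def * using assms by (auto simp: field_differentiable_def intro!: exI)
qed

lemma C1_diff:
  assumes "C1 g" "C1 h"
  shows "C1 (\<lambda>x y. g x y - h x y)"
    and "Dx (\<lambda>x y. g x y - h x y) = (\<lambda>x y. Dx g x y - Dx h x y)"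
    and "Dy (\<lambda>x y. g x y - h x y) = (\<lambda>x y. Dy g x y - Dy h x y)"
proof -
  have "continuous_on UNIV (case_prod (\<lambda>x y. Dx g x y - Dx h x y))"
    "continuous_on UNIV (case_prod (\<lambda>x y. Dy g x y - Dy h x y))"
    using assms by (auto simp: C1_def case_prod_unfold intro!: continuous_on_diff)
  note * = C1_I[OF DERIV_diff DERIV_diff this, OF C1_has_derivative(1) C1_has_derivative(1)
      C1_has_derivative(2) C1_has_derivative(2), OF assms assms]
  show "C1 (\<lambda>x y. g x y - h x y)"
    and "Dx (\<lambda>x y. g x y - h x y) = (\<lambda>x y. Dx g x y - Dx h x y)"
    and "Dy (\<lambda>x y. g x y - h x y) = (\<lambda>x y. Dy g x y - Dy h x y)"
    by (rule *)+
qed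

text \<open>The average is viewed as a function on the plane that is constant in \<open>x\<close>;
  its \<open>y\<close>-derivative is found by differentiating under the integral.\<close>

lemma C1_x_average:
  assumes "C1 g"
  shows "C1 (\<lambda>x. x_average g)"
    and "Dx (\<lambda>x. x_average g) = (\<lambda>x y. 0)"
    and "Dy (\<lambda>x. x_average g) = (\<lambda>x. x_average (Dy g))"
proof -
  have cont: "continuous_on UNIV (case_prod (Dy g))"
    using assms by (simp add: C1_def)
  have cont': "continuous_on UNIV (\<lambda>(y, x). Dy g x y)"
    using continuous_on_compose2[OF cont, of UNIV "\<lambda>(y, x). (x, y)"]
    by (simp add: case_prod_unfold continuous_intros)
  have "(x_average g has_real_derivative x_average (Dy g) y) (at y)" for y
    unfolding x_average_def
    by (rule DERIV_LINT_torus[where U = UNIV])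
      (use cont' C1_has_derivative(2)[OF assms] continuous_slices[OF C1_continuous[OF assms]] in auto)
  moreover have "continuous_on UNIV (case_prod (\<lambda>x. x_average (Dy g)))"
    using continuous_on_compose2[OF continuous_x_average[OF cont], of UNIV snd]
    by (simp add: case_prod_unfold continuous_intros)
  ultimately show "C1 (\<lambda>x. x_average g)" "Dx (\<lambda>x. x_average g) = (\<lambda>x y. 0)"
    "Dy (\<lambda>x. x_average g) = (\<lambda>x. x_average (Dy g))"
    by (auto intro!: C1_I[where gx = "\<lambda>x y. 0" and gy = "\<lambda>x. x_average (Dy g)"])
qed

lemma C2_torus_diff:
  assumes "C2_torus g" "C2_torus h"
  shows "C2_torus (\<lambda>x y. g x y - h x y)"
  using assms by (simp add: C2_torus_def periodic2_def C1_diff)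

lemma C1_zero: "C1 (\<lambda>x y. 0)" "Dx (\<lambda>x y. 0) = (\<lambda>x y. 0)" "Dy (\<lambda>x y. 0) = (\<lambda>x y. 0)"
  by (auto simp: C1_def Dx_def[abs_def] Dy_def[abs_def] case_prod_unfold field_differentiable_const)

lemma periodic2_x_average: "periodic2 g \<Longrightarrow> periodic2 (\<lambda>x. x_average g)"
  by (simp add: periodic2_def x_average_def)

lemma C2_torus_x_average:
  assumes "C2_torus g"
  shows "C2_torus (\<lambda>x. x_average g)"
  using assms by (simp add: C2_torus_def periodic2_x_average C1_x_average C1_zero)

section \<open>Periodicity of derivatives\<close>

lemma Dx_periodic:
  assumes "C1 g" "periodic2 g"
  shows "Dx g (x + 1) y = Dx g x y"
proof -
  have "((\<lambda>s. g (s + 1) y) has_real_derivative Dx g (x + 1) y) (at x)"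
    using C1_has_derivative(1)[OF assms(1)] by (rule DERIV_shift[THEN iffD1])
  then have "((\<lambda>s. g s y) has_real_derivative Dx g (x + 1) y) (at x)"
    using assms(2) by (simp add: periodic2_def)
  then show ?thesis
    using C1_has_derivative(1)[OF assms(1)] DERIV_unique by blast
qed

lemma Dy_periodic:
  assumes "C1 g" "periodic2 g"
  shows "Dy g x (y + 1) = Dy g x y"
proof -
  have "((\<lambda>s. g x (s + 1)) has_real_derivative Dy g x (y + 1)) (at y)"
    using C1_has_derivative(2)[OF assms(1)] by (rule DERIV_shift[THEN iffD1])
  then have "((\<lambda>s. g x s) has_real_derivative Dy g x (y + 1)) (at y)"
    using assms(2) by (simp add: periodic2_def)
  then show ?thesis
    using C1_has_derivative(2)[OF assms(1)] DERIV_unique by blast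
qed

text \<open>Removes the transport term and the second \<open>x\<close>-derivative from the averaged
  equation.\<close>

lemma x_average_Dx:
  assumes "C1 g" "\<And>x y. g (x + 1) y = g x y"
  shows "x_average (Dx g) y = 0"
  unfolding x_average_def
  by (rule LINT_torus_periodic_derivative[where F = "\<lambda>x. g x y"])
    (use assms C1_has_derivative(1) in \<open>auto intro: continuous_slices simp: C1_def\<close>)

section \<open>Joint regularity in time and space\<close>

lemma continuous_pos_time_slice:
  assumes "continuous_pos_time f" "0 < t"
  shows "continuous_on UNIV (case_prod (f t))"
proof -
  have "continuous_on UNIV (\<lambda>p. (\<lambda>(t, x, y). f t x y) (t, p))"
    by (rule continuous_on_compose2[OF assms(1)[unfolded continuous_pos_time_def]])
      (use assms(2) in \<open>auto intro!: continuous_intros\<close>)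
  then show ?thesis
    by (simp add: case_prod_unfold)
qed

lemma continuous_pos_time_diff:
  assumes "continuous_pos_time f" "continuous_pos_time g"
  shows "continuous_pos_time (\<lambda>t x y. f t x y - g t x y)"
  using continuous_on_diff assms unfolding continuous_pos_time_def case_prod_unfold by blast

text \<open>The formulas for derivatives of differences and averages are available only for positive
  times, so agreement is asked only there.\<close>

lemma continuous_pos_time_cong:
  assumes "continuous_pos_time f" "\<And>t x y. 0 < t \<Longrightarrow> f t x y = g t x y"
  shows "continuous_pos_time g"
  using assms unfolding continuous_pos_time_def case_prod_unfold
  by (auto elim!: continuous_on_eq)

lemma continuous_on_x_average_pos_time:
  assumes "continuous_pos_time f"
  shows "continuous_on ({0<..} \<times> UNIV) (\<lambda>(t, y). x_average (f t) y)"
proof -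
  have "continuous_on (({0<..} \<times> UNIV) \<times> UNIV) (\<lambda>q. (\<lambda>(t, x, y). f t x y) (fst (fst q), snd q, snd (fst q)))"
    by (rule continuous_on_compose2[OF assms[unfolded continuous_pos_time_def]])
      (auto intro!: continuous_intros)
  then have "continuous_on (({0<..} \<times> UNIV) \<times> UNIV) (\<lambda>(p, x). f (fst p) x (snd p))"
    by (simp add: case_prod_unfold)
  then show ?thesis
    using continuous_on_LINT_torus by (simp add: x_average_def case_prod_unfold)
qed

lemma continuous_pos_time_x_average:
  assumes "continuous_pos_time f"
  shows "continuous_pos_time (\<lambda>t x. x_average (f t))"
proof -
  have "continuous_on {(t, x, y). 0 < t} (\<lambda>p. (\<lambda>(t, y). x_average (f t) y) (fst p, snd (snd p)))"
    by (rule continuous_on_compose2[OF continuous_on_x_average_pos_time[OF assms]])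
      (auto intro!: continuous_intros)
  then show ?thesis
    by (simp add: continuous_pos_time_def case_prod_unfold)
qed

lemma C12_torus_has_time_derivative:
  assumes "C12_torus f" "0 < t"
  shows "((\<lambda>s. f s x y) has_real_derivative Dt f t x y) (at t)"
  using assms by (simp add: C12_torus_def Dt_def DERIV_deriv_iff_field_differentiable)

lemma C12_torus_diff:
  assumes f: "C12_torus f" and g: "C12_torus g"
  shows "C12_torus (\<lambda>t x y. f t x y - g t x y)"
    and "0 < t \<Longrightarrow> Dt (\<lambda>t x y. f t x y - g t x y) t x y = Dt f t x y - Dt g t x y"
    and "0 < t \<Longrightarrow> Dx (\<lambda>x y. f t x y - g t x y) x y = Dx (f t) x y - Dx (g t) x y"
    and "0 < t \<Longrightarrow> Laplacian (\<lambda>x y. f t x y - g t x y) x y = Laplacian (f t) x y - Laplacian (g t) x y"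
proof -
  have C2: "C2_torus (f t)" "C2_torus (g t)" if "0 < t" for t
    using f g that by (simp_all add: C12_torus_def)
  have deriv: "((\<lambda>s. f s x y - g s x y) has_real_derivative Dt f t x y - Dt g t x y) (at t)"
    if "0 < t" for t x y
    using C12_torus_has_time_derivative f g that DERIV_diff by blast
  then show Dt: "Dt (\<lambda>t x y. f t x y - g t x y) t x y = Dt f t x y - Dt g t x y" if "0 < t" for t x y
    using that by (simp add: Dt_def[of "\<lambda>t x y. f t x y - g t x y"] DERIV_imp_deriv)
  have D: "Dx (\<lambda>x y. f t x y - g t x y) = (\<lambda>x y. Dx (f t) x y - Dx (g t) x y)"
    "Dy (\<lambda>x y. f t x y - g t x y) = (\<lambda>x y. Dy (f t) x y - Dy (g t) x y)"
    "Dx (\<lambda>x y. Dx (f t) x y - Dx (g t) x y) = (\<lambda>x y. Dx (Dx (f t)) x y - Dx (Dx (g t)) x y)"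
    "Dy (\<lambda>x y. Dx (f t) x y - Dx (g t) x y) = (\<lambda>x y. Dy (Dx (f t)) x y - Dy (Dx (g t)) x y)"
    "Dx (\<lambda>x y. Dy (f t) x y - Dy (g t) x y) = (\<lambda>x y. Dx (Dy (f t)) x y - Dx (Dy (g t)) x y)"
    "Dy (\<lambda>x y. Dy (f t) x y - Dy (g t) x y) = (\<lambda>x y. Dy (Dy (f t)) x y - Dy (Dy (g t)) x y)"
    if "0 < t" for t
    using C2[OF that] by (simp_all add: C2_torus_def C1_diff)
  show "0 < t \<Longrightarrow> Dx (\<lambda>x y. f t x y - g t x y) x y = Dx (f t) x y - Dx (g t) x y"
    "0 < t \<Longrightarrow> Laplacian (\<lambda>x y. f t x y - g t x y) x y = Laplacian (f t) x y - Laplacian (g t) x y"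
    by (simp_all add: D Laplacian_def)
  \<comment> \<open>For positive times each function in question is a difference of the
    corresponding functions of \<open>f\<close> and \<open>g\<close>, so this one rule serves all
    eight continuity goals.\<close>
  have cong: "continuous_pos_time h"
    if "continuous_pos_time f'" "continuous_pos_time g'"
      "\<And>t x y. 0 < t \<Longrightarrow> h t x y = f' t x y - g' t x y" for h f' g'
    using continuous_pos_time_cong[OF continuous_pos_time_diff[OF that(1,2)]] that(3) by simp
  show "C12_torus (\<lambda>t x y. f t x y - g t x y)"
    unfolding C12_torus_def
  proof (intro conjI allI impI)
    show "C2_torus (\<lambda>x y. f t x y - g t x y)" if "0 < t" for t
      using C2[OF that] by (rule C2_torus_diff)
    show "(\<lambda>s. f s x y - g s x y) field_differentiable at t" if "0 < t" for t x y
      using deriv[OF that] by (auto simp: field_differentiable_def)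
  qed (rule cong; use f g Dt D in \<open>force simp: C12_torus_def\<close>)+
qed

lemma C12_torus_x_average:
  assumes f: "C12_torus f"
  shows "C12_torus (\<lambda>t x. x_average (f t))"
    and "0 < t \<Longrightarrow> Dt (\<lambda>t x. x_average (f t)) t x y = x_average (Dt f t) y"
    and "0 < t \<Longrightarrow> Dx (\<lambda>x. x_average (f t)) x y = 0"
    and "0 < t \<Longrightarrow> Laplacian (\<lambda>x. x_average (f t)) x y = x_average (Dy (Dy (f t))) y"
proof -
  have C2: "C2_torus (f t)" if "0 < t" for t
    using f that by (simp add: C12_torus_def)
  have cont: "continuous_pos_time f" "continuous_pos_time (Dt f)"
    using f by (simp_all add: C12_torus_def)
  have deriv: "((\<lambda>s. x_average (f s) y) has_real_derivative x_average (Dt f t) y) (at t)"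
    if "0 < t" for t y
    unfolding x_average_def
  proof (rule DERIV_LINT_torus[where U = "{0<..}"])
    show "((\<lambda>s. f s x y) has_real_derivative Dt f s x y) (at s)" if "s \<in> {0<..}" for s x
      using C12_torus_has_time_derivative[OF f] that by simp
    show "continuous_on UNIV (\<lambda>x. f s x y)" if "s \<in> {0<..}" for s
      using continuous_slices(1)[OF continuous_pos_time_slice[OF cont(1)]] that by simp
    have "continuous_on ({0<..} \<times> UNIV) (\<lambda>q. (\<lambda>(t, x, y). Dt f t x y) (fst q, snd q, y))"
      by (rule continuous_on_compose2[OF cont(2)[unfolded continuous_pos_time_def]])
        (auto intro!: continuous_intros)
    then show "continuous_on ({0<..} \<times> UNIV) (\<lambda>(s, x). Dt f s x y)"
      by (simp add: case_prod_unfold)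
  qed (use that in auto)
  then show Dt: "Dt (\<lambda>t x. x_average (f t)) t x y = x_average (Dt f t) y" if "0 < t" for t x y
    using that by (simp add: Dt_def[of "\<lambda>t x. x_average (f t)"] DERIV_imp_deriv)
  have D: "Dx (\<lambda>x. x_average (f t)) = (\<lambda>x y. 0)"
    "Dy (\<lambda>x. x_average (f t)) = (\<lambda>x. x_average (Dy (f t)))"
    "Dx (\<lambda>x. x_average (Dy (f t))) = (\<lambda>x y. 0)"
    "Dy (\<lambda>x. x_average (Dy (f t))) = (\<lambda>x. x_average (Dy (Dy (f t))))"
    if "0 < t" for t
    using C2[OF that] by (simp_all add: C2_torus_def C1_x_average)
  show "0 < t \<Longrightarrow> Dx (\<lambda>x. x_average (f t)) x y = 0"
    "0 < t \<Longrightarrow> Laplacian (\<lambda>x. x_average (f t)) x y = x_average (Dy (Dy (f t))) y"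
    by (simp_all add: D C1_zero Laplacian_def)
  \<comment> \<open>Covers the four derivatives of the average that involve \<open>x\<close>: for
    positive times they vanish identically.\<close>
  have zero: "continuous_pos_time h" if "\<And>t x y. 0 < t \<Longrightarrow> h t x y = 0" for h
    by (rule continuous_pos_time_cong[where f = "\<lambda>t x y. 0"])
      (use that in \<open>auto simp: continuous_pos_time_def case_prod_unfold\<close>)
  have avg: "continuous_pos_time h"
    if "continuous_pos_time g" "\<And>t x y. 0 < t \<Longrightarrow> h t x y = x_average (g t) y" for g h
    using continuous_pos_time_cong[OF continuous_pos_time_x_average[OF that(1)]] that(2) by simp
  show "C12_torus (\<lambda>t x. x_average (f t))"
    unfolding C12_torus_def
  proof (intro conjI allI impI)
    show "C2_torus (\<lambda>x. x_average (f t))" if "0 < t" for t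
      using C2[OF that] by (rule C2_torus_x_average)
    show "(\<lambda>s. x_average (f s) y) field_differentiable at t" if "0 < t" for t and x :: real and y
      using deriv[OF that] by (auto simp: field_differentiable_def)
    show "continuous_pos_time (\<lambda>t x. x_average (f t))"
      using cont(1) by (rule continuous_pos_time_x_average)
    show "continuous_pos_time (Dt (\<lambda>t x. x_average (f t)))"
      using cont(2) Dt by (rule avg)
    show "continuous_pos_time (\<lambda>t. Dy (\<lambda>x. x_average (f t)))"
      by (rule avg[where g = "\<lambda>t. Dy (f t)"]) (use f D in \<open>auto simp: C12_torus_def\<close>)
    show "continuous_pos_time (\<lambda>t. Dy (Dy (\<lambda>x. x_average (f t))))"
      by (rule avg[where g = "\<lambda>t. Dy (Dy (f t))"]) (use f D in \<open>auto simp: C12_torus_def\<close>)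
  qed (rule zero; simp add: D C1_zero)+
qed

section \<open>Shear solutions\<close>

lemma shear_solution_continuous:
  assumes "shear_solution u \<nu> F f" "0 < t"
  shows "continuous_on UNIV (case_prod (f t))"
  using assms continuous_pos_time_slice by (simp add: shear_solution_def C12_torus_def)

lemma shear_solution_in_L2:
  assumes "shear_solution u \<nu> F f" "0 \<le> t"
  shows "in_L2 (f t)"
proof (cases "t = 0")
  case True
  then show ?thesis
    using assms(1) by (simp add: shear_solution_def)
next
  case False
  then show ?thesis
    using assms by (intro in_L2_continuous shear_solution_continuous) auto
qed

text \<open>The transport and diffusion terms are linear and the forcings subtract. Two species with
  the same reaction term therefore have an unforced difference.\<close>

lemma shear_solution_diff:
  assumes f: "shear_solution u \<nu> F f" and g: "shear_solution u \<nu> G g"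
  shows "shear_solution u \<nu> (\<lambda>t x y. F t x y - G t x y) (\<lambda>t x y. f t x y - g t x y)"
proof -
  have C12: "C12_torus f" "C12_torus g"
    using f g by (simp_all add: shear_solution_def)
  have eq: "Dt (\<lambda>t x y. f t x y - g t x y) t x y + u y * Dx (\<lambda>x y. f t x y - g t x y) x y =
      \<nu> * Laplacian (\<lambda>x y. f t x y - g t x y) x y + (F t x y - G t x y)" if "0 < t" for t x y
  proof -
    have "Dt f t x y + u y * Dx (f t) x y = \<nu> * Laplacian (f t) x y + F t x y"
      "Dt g t x y + u y * Dx (g t) x y = \<nu> * Laplacian (g t) x y + G t x y"
      using f g that by (simp_all add: shear_solution_def)
    then show ?thesis
      by (simp add: C12_torus_diff(2-)[OF C12 that] algebra_simps)
  qed
  let ?f = "\<lambda>t x y. f t x y - f 0 x y" and ?g = "\<lambda>t x y. g t x y - g 0 x y"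
  \<comment> \<open>The initial datum is attained because the increment of the difference is
    dominated by the increments of both solutions.\<close>
  have "((\<lambda>t. sqrt 2 * (L2_norm (?f t) + L2_norm (?g t))) \<longlongrightarrow> sqrt 2 * (0 + 0)) (at_right 0)"
    using f g by (intro tendsto_intros) (simp_all add: shear_solution_def)
  then have lim: "((\<lambda>t. sqrt 2 * (L2_norm (?f t) + L2_norm (?g t))) \<longlongrightarrow> 0) (at_right 0)"
    by simp
  have "L2_norm (\<lambda>x y. ?f t x y - ?g t x y) \<le> sqrt 2 * (L2_norm (?f t) + L2_norm (?g t))"
    if "0 < t" for t
    using that by (intro in_L2_diff shear_solution_in_L2[OF f] shear_solution_in_L2[OF g]) auto
  then have "eventually (\<lambda>t. L2_norm (\<lambda>x y. ?f t x y - ?g t x y) \<le>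
      sqrt 2 * (L2_norm (?f t) + L2_norm (?g t))) (at_right 0)"
    by (auto simp: eventually_at_right_field intro: exI[of _ 1])
  then have "((\<lambda>t. L2_norm (\<lambda>x y. ?f t x y - ?g t x y)) \<longlongrightarrow> 0) (at_right 0)"
    by (intro tendsto_sandwich[OF _ _ tendsto_const lim]) auto
  then have "((\<lambda>t. L2_norm (\<lambda>x y. f t x y - g t x y - (f 0 x y - g 0 x y))) \<longlongrightarrow> 0) (at_right 0)"
    by (simp add: algebra_simps)
  moreover have "periodic2 (\<lambda>x y. f 0 x y - g 0 x y)"
    using f g by (simp add: shear_solution_def periodic2_def)
  moreover have "in_L2 (\<lambda>x y. f 0 x y - g 0 x y)"
    by (rule in_L2_diff[OF shear_solution_in_L2[OF f] shear_solution_in_L2[OF g]]) auto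
  ultimately show ?thesis
    using eq C12_torus_diff(1)[OF C12] by (simp add: shear_solution_def)
qed

text \<open>The velocity is constant along each line of fixed \<open>y\<close>, so it leaves the
  integral in \<open>x\<close>; the transport term and the second \<open>x\<close>-derivative then
  integrate to zero by periodicity.\<close>

lemma x_average_shear_equation:
  assumes f: "shear_solution u \<nu> F f" and t: "0 < t"
  shows "x_average (Dt f t) y = \<nu> * x_average (Dy (Dy (f t))) y + x_average (F t) y"
proof -
  have C12: "C12_torus f"
    using f by (simp add: shear_solution_def)
  then have C2: "C2_torus (f t)"
    using t by (simp add: C12_torus_def)
  have cont: "continuous_on UNIV (case_prod (Dt f t))" "continuous_on UNIV (case_prod (Dx (f t)))"
    "continuous_on UNIV (case_prod (Dx (Dx (f t))))" "continuous_on UNIV (case_prod (Dy (Dy (f t))))"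
    using C12 C2 continuous_pos_time_slice[of "Dt f"] t by (auto simp: C12_torus_def C2_torus_def C1_def)
  note int = cont[THEN continuous_slices(1), THEN integrable_torus]
  \<comment> \<open>The forcing is arbitrary, so the equation is solved for it: its integrability in
    \<open>x\<close> is inherited from the continuous terms on the right.\<close>
  have "F t x y = Dt f t x y + u y * Dx (f t) x y - \<nu> * Dx (Dx (f t)) x y - \<nu> * Dy (Dy (f t)) x y" for x y
    using f t unfolding shear_solution_def Laplacian_def by (simp add: algebra_simps)
  then have "x_average (F t) y = x_average (Dt f t) y + u y * x_average (Dx (f t)) y
      - \<nu> * x_average (Dx (Dx (f t))) y - \<nu> * x_average (Dy (Dy (f t))) y"
    using int by (simp add: x_average_def)
  moreover have "x_average (Dx (f t)) y = 0" "x_average (Dx (Dx (f t))) y = 0"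
    using C2 by (auto intro!: x_average_Dx Dx_periodic simp: C2_torus_def periodic2_def)
  ultimately show ?thesis
    by simp
qed

text \<open>A function constant in \<open>x\<close> has no transport term, so the averaged heat
  equation is again a shear equation. Subtracting the average from a solution then shows that the
  fluctuation is a shear solution too. Contraction of averaging in L2 carries over the initial
  condition.\<close>

lemma shear_solution_x_average:
  assumes f: "shear_solution u \<nu> F f" and f0: "continuous_on UNIV (case_prod (f 0))"
  shows "shear_solution u \<nu> (\<lambda>t x. x_average (F t)) (\<lambda>t x. x_average (f t))"
proof -
  have C12: "C12_torus f"
    using f by (simp add: shear_solution_def)
  have eq: "Dt (\<lambda>t x. x_average (f t)) t x y + u y * Dx (\<lambda>x. x_average (f t)) x y =
      \<nu> * Laplacian (\<lambda>x. x_average (f t)) x y + x_average (F t) y" if "0 < t" for t x y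
    using x_average_shear_equation[OF f that] C12_torus_x_average(2-)[OF C12 that] by simp
  have lim: "((\<lambda>t. L2_norm (\<lambda>x y. f t x y - f 0 x y)) \<longlongrightarrow> 0) (at_right 0)"
    using f by (simp add: shear_solution_def)
  have "L2_norm (\<lambda>x y. x_average (f t) y - x_average (f 0) y) \<le> L2_norm (\<lambda>x y. f t x y - f 0 x y)"
    if "0 < t" for t
  proof -
    note ft = shear_solution_continuous[OF f that]
    have "continuous_on UNIV (case_prod (\<lambda>x y. f t x y - f 0 x y))"
      using ft f0 by (auto simp: case_prod_unfold intro!: continuous_on_diff)
    from L2_norm_x_average(1)[OF this] show ?thesis
      by (simp add: x_average_diff[OF ft f0])
  qed
  then have "eventually (\<lambda>t. L2_norm (\<lambda>x y. x_average (f t) y - x_average (f 0) y) \<le>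
      L2_norm (\<lambda>x y. f t x y - f 0 x y)) (at_right 0)"
    by (auto simp: eventually_at_right_field intro: exI[of _ 1])
  then have "((\<lambda>t. L2_norm (\<lambda>x y. x_average (f t) y - x_average (f 0) y)) \<longlongrightarrow> 0) (at_right 0)"
    by (intro tendsto_sandwich[OF _ _ tendsto_const lim]) auto
  moreover have "in_L2 (\<lambda>x. x_average (f 0))"
    using f0 by (intro in_L2_continuous continuous_x_average_plane)
  moreover have "periodic2 (\<lambda>x. x_average (f 0))"
    using f by (simp add: shear_solution_def periodic2_x_average)
  ultimately show ?thesis
    using eq C12_torus_x_average(1)[OF C12] by (simp add: shear_solution_def)
qed

text \<open>On a space of mass one the L1 norm is at most the L2 norm, so the reverse triangle
  inequality applies. Estimates obtained for positive times are extended to time 0 through this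
  limit.\<close>

lemma shear_solution_L1_tendsto:
  assumes f: "shear_solution u \<nu> F f"
  shows "((\<lambda>t. L1_norm (f t)) \<longlongrightarrow> L1_norm (f 0)) (at_right 0)"
proof -
  have "\<bar>L1_norm (f t) - L1_norm (f 0)\<bar> \<le> L2_norm (\<lambda>x y. f t x y - f 0 x y)" if "0 < t" for t
  proof -
    have L2: "in_L2 (f t)" "in_L2 (f 0)"
      using shear_solution_in_L2[OF f] that by simp_all
    have "L1_norm (\<lambda>x y. f t x y - f 0 x y) \<le> L2_norm (\<lambda>x y. f t x y - f 0 x y)"
      using in_L2_diff(1)[OF L2] by (rule L1_norm_le_L2_norm)
    then show ?thesis
      using L1_norm_triangle[OF integrable_in_L2 integrable_in_L2, OF L2]
        L1_norm_triangle[OF integrable_in_L2 integrable_in_L2, OF L2(2,1)]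
        L1_norm_minus_commute[of "f 0" "f t"] by linarith
  qed
  then have "eventually (\<lambda>t. norm (L1_norm (f t) - L1_norm (f 0)) \<le>
      L2_norm (\<lambda>x y. f t x y - f 0 x y)) (at_right 0)"
    by (auto simp: eventually_at_right_field intro: exI[of _ 1])
  then have "((\<lambda>t. L1_norm (f t) - L1_norm (f 0)) \<longlongrightarrow> 0) (at_right 0)"
    by (rule Lim_null_comparison) (use f in \<open>simp add: shear_solution_def\<close>)
  then show ?thesis
    by (simp add: LIM_zero_iff)
qed

text \<open>For a nonnegative solution the L1 norm is the total mass. Transport and diffusion
  conserve mass by periodicity, so only the forcing contributes.\<close>

lemma shear_solution_L1_derivative:
  assumes f: "shear_solution u \<nu> F f" and t: "0 < t"
    and nonneg: "\<And>s x y. 0 < s \<Longrightarrow> 0 \<le> f s x y"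
    and F: "continuous_on UNIV (case_prod (F t))"
  shows "((\<lambda>s. L1_norm (f s)) has_real_derivative (LINT (x, y)|torus2. F t x y)) (at t)"
proof -
  have C12: "C12_torus f"
    using f by (simp add: shear_solution_def)
  have C2: "C2_torus (f t)"
    using C12 t by (simp add: C12_torus_def)
  have L1: "L1_norm (f s) = (LINT y|torus. x_average (f s) y)" if "0 < s" for s
    using nonneg[OF that] LINT_torus2[OF integrable_torus2[OF shear_solution_continuous[OF f that]]]
    by (simp add: L1_norm_def)
  have "((\<lambda>s. LINT y|torus. x_average (f s) y) has_real_derivative
      (LINT y|torus. x_average (Dt f t) y)) (at t)"
  proof (rule DERIV_LINT_torus[where U = "{0<..}"])
    show "((\<lambda>s. x_average (f s) y) has_real_derivative x_average (Dt f s) y) (at s)"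
      if "s \<in> {0<..}" for s y
      using C12_torus_has_time_derivative[OF C12_torus_x_average(1)[OF C12], of s]
        C12_torus_x_average(2)[OF C12] that by simp
    show "continuous_on UNIV (x_average (f s))" if "s \<in> {0<..}" for s
      using that by (intro continuous_x_average shear_solution_continuous[OF f]) simp
    show "continuous_on ({0<..} \<times> UNIV) (\<lambda>(s, y). x_average (Dt f s) y)"
      using C12 by (intro continuous_on_x_average_pos_time) (simp add: C12_torus_def)
  qed (use t in auto)
  moreover have "(LINT y|torus. x_average (Dt f t) y) = (LINT (x, y)|torus2. F t x y)"
  proof -
    have C1: "C1 (\<lambda>x. x_average (Dy (f t)))"
      and D: "Dy (\<lambda>x. x_average (Dy (f t))) = (\<lambda>x. x_average (Dy (Dy (f t))))"
      using C2 by (auto simp: C2_torus_def C1_x_average)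
    have cont: "continuous_on UNIV (x_average (Dy (Dy (f t))))"
      using C2 by (intro continuous_x_average) (simp add: C2_torus_def C1_def)
    have "(LINT y|torus. x_average (Dy (Dy (f t))) y) = 0"
    proof (rule LINT_torus_periodic_derivative[OF _ cont])
      show "(x_average (Dy (f t)) has_real_derivative x_average (Dy (Dy (f t))) y) (at y)" for y
        using C1_has_derivative(2)[OF C1] D by simp
      show "x_average (Dy (f t)) (y + 1) = x_average (Dy (f t)) y" for y
        using C2 by (simp add: x_average_def Dy_periodic C2_torus_def)
    qed
    then show ?thesis
      using LINT_torus2[OF integrable_torus2[OF F]] x_average_shear_equation[OF f t]
        integrable_torus[OF cont] integrable_torus[OF continuous_x_average[OF F]]
      by simp
  qed
  ultimately have "((\<lambda>s. LINT y|torus. x_average (f s) y) has_real_derivative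
      (LINT (x, y)|torus2. F t x y)) (at t)"
    by simp
  then show ?thesis
    by (rule has_field_derivative_transform_within_open[where S = "{0<..}"]) (use t L1 in auto)
qed

section \<open>L1 contraction of the heat flow on the circle\<close>

text \<open>The energy \<open>\<integral> \<phi>(h)\<close> with the convex regularisation \<open>\<phi>(z) = sqrt (z\<^sup>2 + \<eta>\<^sup>2)\<close> of \<open>\<bar>z\<bar>\<close> decreases,
  because integration by parts turns its derivative into \<open>-\<nu> \<integral> \<phi>''(h) h\<^sub>y\<^sup>2\<close>.\<close>

lemma heat_L1_contraction:
  fixes h hy hyy :: "real \<Rightarrow> real \<Rightarrow> real"
  assumes ht: "\<And>s y. 0 < s \<Longrightarrow> ((\<lambda>s. h s y) has_real_derivative \<nu> * hyy s y) (at s)"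
    and hy: "\<And>s y. 0 < s \<Longrightarrow> (h s has_real_derivative hy s y) (at y)"
    and hyy: "\<And>s y. 0 < s \<Longrightarrow> (hy s has_real_derivative hyy s y) (at y)"
    and per: "\<And>s y. 0 < s \<Longrightarrow> h s (y + 1) = h s y" "\<And>s y. 0 < s \<Longrightarrow> hy s (y + 1) = hy s y"
    and cont: "continuous_on ({0<..} \<times> UNIV) (\<lambda>(s, y). h s y)"
      "continuous_on ({0<..} \<times> UNIV) (\<lambda>(s, y). hyy s y)"
    and "0 \<le> \<nu>" "0 < s" "s \<le> t"
  shows "(LINT y|torus. \<bar>h t y\<bar>) \<le> (LINT y|torus. \<bar>h s y\<bar>)"
proof (rule field_le_epsilon)
  \<comment> \<open>The same \<open>\<eta>\<close> is the margin of the inequality and the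
    regularisation parameter, because
    \<open>\<bar>z\<bar> \<le> \<phi> z \<le> \<bar>z\<bar> + \<eta>\<close> on a torus of mass
    one.\<close>
  fix \<eta> :: real assume \<eta>: "0 < \<eta>"
  define \<phi> where "\<phi> = (\<lambda>z::real. sqrt (z\<^sup>2 + \<eta>\<^sup>2))"
  define \<phi>' where "\<phi>' = (\<lambda>z. z / \<phi> z)"
  define \<phi>'' where "\<phi>'' = (\<lambda>z. \<eta>\<^sup>2 / (\<phi> z)^3)"
  have pos: "0 < z\<^sup>2 + \<eta>\<^sup>2" for z
    using \<eta> by (simp add: add_nonneg_pos)
  then have \<phi>_pos: "0 < \<phi> z" for z
    by (simp add: \<phi>_def)
  then have [simp]: "\<phi> z \<noteq> 0" for z
    using less_irrefl by metis
  have \<phi>_sq: "\<phi> z * \<phi> z = z\<^sup>2 + \<eta>\<^sup>2" for z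
    using pos[of z] by (simp add: \<phi>_def)
  have d\<phi>: "(\<phi> has_real_derivative \<phi>' z) (at z)" for z
    unfolding \<phi>_def \<phi>'_def using pos[of z]
    by (auto intro!: derivative_eq_intros simp: divide_simps)
  have d\<phi>': "(\<phi>' has_real_derivative \<phi>'' z) (at z)" for z
  proof -
    \<comment> \<open>With this identity the quotient rule for \<open>z / \<phi> z\<close> collapses
      to \<open>\<eta>\<^sup>2 / (\<phi> z)^3\<close>, whose positivity is the convexity of
      \<open>\<phi>\<close>.\<close>
    have "\<eta>\<^sup>2 = \<phi> z * \<phi> z - z * z"
      by (simp add: \<phi>_sq power2_eq_square)
    then have "(\<phi> z - z * \<phi>' z) / (\<phi> z * \<phi> z) = \<phi>'' z"
      unfolding \<phi>''_def \<phi>'_def by (simp add: field_simps power3_eq_cube)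
    then show ?thesis
      using DERIV_divide[OF DERIV_ident d\<phi>, of z] unfolding \<phi>'_def by simp
  qed
  have c\<phi>: "continuous_on UNIV \<phi>" "continuous_on UNIV \<phi>'"
    using d\<phi> d\<phi>' by (meson DERIV_isCont continuous_at_imp_continuous_on)+
  then have c\<phi>'': "continuous_on UNIV \<phi>''"
    unfolding \<phi>''_def by (intro continuous_intros) auto
  have h_cont: "continuous_on UNIV (h r)" "continuous_on UNIV (hy r)" if "0 < r" for r
    using hy[OF that] hyy[OF that] by (meson DERIV_isCont continuous_at_imp_continuous_on)+
  have hyy_cont: "continuous_on UNIV (hyy r)" if "0 < r" for r
    using continuous_on_compose2[OF cont(2), of UNIV "\<lambda>y. (r, y)"] that
    by (simp add: continuous_intros image_subset_iff)
  define E where "E = (\<lambda>r. LINT y|torus. \<phi> (h r y))"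
  have dE: "(E has_real_derivative (LINT y|torus. \<phi>' (h r y) * (\<nu> * hyy r y))) (at r)" if "0 < r" for r
    unfolding E_def
  proof (rule DERIV_LINT_torus[where U = "{0<..}"])
    show "((\<lambda>s. \<phi> (h s y)) has_real_derivative \<phi>' (h s y) * (\<nu> * hyy s y)) (at s)"
      if "s \<in> {0<..}" for s y
      using that by (intro DERIV_chain2[OF d\<phi> ht]) simp
    show "continuous_on UNIV (\<lambda>y. \<phi> (h s y))" if "s \<in> {0<..}" for s
      using that continuous_on_compose2[OF c\<phi>(1) h_cont(1)] by simp
    show "continuous_on ({0<..} \<times> UNIV) (\<lambda>(s, y). \<phi>' (h s y) * (\<nu> * hyy s y))"
      using cont continuous_on_compose2[OF c\<phi>(2) cont(1)]
      by (auto simp: case_prod_unfold intro!: continuous_intros)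
  qed (use that in auto)
  have dE_le: "(LINT y|torus. \<phi>' (h r y) * (\<nu> * hyy r y)) \<le> 0" if r: "0 < r" for r
  proof -
    have c1: "continuous_on UNIV (\<lambda>y. \<phi>' (h r y) * hyy r y)"
      and c2: "continuous_on UNIV (\<lambda>y. \<phi>'' (h r y) * (hy r y)\<^sup>2)"
      using c\<phi> c\<phi>'' h_cont[OF r] hyy_cont[OF r]
      by (auto intro!: continuous_intros intro: continuous_on_compose2)
    \<comment> \<open>Integration by parts: the integrand is the derivative of the periodic function
      \<open>\<phi>' (h r y) * hy r y\<close>.\<close>
    have "(LINT y|torus. \<phi>' (h r y) * hyy r y + \<phi>'' (h r y) * (hy r y)\<^sup>2) = 0"
    proof (rule LINT_torus_periodic_derivative[where F = "\<lambda>y. \<phi>' (h r y) * hy r y"])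
      show "((\<lambda>y. \<phi>' (h r y) * hy r y) has_real_derivative
          \<phi>' (h r y) * hyy r y + \<phi>'' (h r y) * (hy r y)\<^sup>2) (at y)" for y
        using DERIV_mult[OF DERIV_chain2[OF d\<phi>' hy[OF r]] hyy[OF r], of y]
        by (simp add: power2_eq_square algebra_simps)
    qed (use c1 c2 per[OF r] in \<open>auto intro: continuous_on_add\<close>)
    then have "(LINT y|torus. \<phi>' (h r y) * hyy r y) = - (LINT y|torus. \<phi>'' (h r y) * (hy r y)\<^sup>2)"
      using integrable_torus[OF c1] integrable_torus[OF c2] by simp
    moreover have "0 \<le> (LINT y|torus. \<phi>'' (h r y) * (hy r y)\<^sup>2)"
      using \<phi>_pos by (intro integral_nonneg_AE AE_I2) (simp add: \<phi>''_def less_imp_le)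
    moreover have "(LINT y|torus. \<phi>' (h r y) * (\<nu> * hyy r y)) = \<nu> * (LINT y|torus. \<phi>' (h r y) * hyy r y)"
      by (simp add: mult.left_commute)
    ultimately show ?thesis
      using \<open>0 \<le> \<nu>\<close> by (simp add: mult_nonneg_nonneg)
  qed
  have "E t \<le> E s"
    using \<open>0 < s\<close> by (intro DERIV_nonpos_imp_nonincreasing[OF \<open>s \<le> t\<close>]) (meson dE dE_le less_le_trans)
  moreover have int: "integrable torus (\<lambda>y. \<bar>h r y\<bar>)" "integrable torus (\<lambda>y. \<phi> (h r y))" if "0 < r" for r
    using h_cont[OF that] continuous_on_compose2[OF c\<phi>(1) h_cont(1)[OF that]]
    by (auto intro!: integrable_torus continuous_intros)
  moreover have "(LINT y|torus. \<bar>h t y\<bar>) \<le> E t"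
    unfolding E_def using int \<open>0 < s\<close> \<open>s \<le> t\<close>
    by (intro integral_mono) (auto simp: \<phi>_def intro: real_le_rsqrt)
  moreover have "E s \<le> (LINT y|torus. \<bar>h s y\<bar> + \<eta>)"
    unfolding E_def using int \<open>0 < s\<close> \<eta> sqrt_sum_squares_le_sum_abs[of _ \<eta>]
    by (intro integral_mono) (auto simp: \<phi>_def)
  ultimately show "(LINT y|torus. \<bar>h t y\<bar>) \<le> (LINT y|torus. \<bar>h s y\<bar>) + \<eta>"
    using \<open>0 < s\<close> by simp
qed

text \<open>The average solves the heat equation in \<open>y\<close>, so its L1 norm is
  nonincreasing between positive times; the earlier time is then sent to 0.\<close>

lemma shear_solution_x_average_L1_contraction:
  assumes f: "shear_solution u \<nu> (\<lambda>t x y. 0) f" and f0: "continuous_on UNIV (case_prod (f 0))"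
    and "0 \<le> \<nu>" and t: "0 < t"
  shows "L1_norm_y (x_average (f t)) \<le> L1_norm_y (x_average (f 0))"
proof -
  have C12: "C12_torus f"
    using f by (simp add: shear_solution_def)
  have C2: "C2_torus (f s)" if "0 < s" for s
    using C12 that by (simp add: C12_torus_def)
  have mono: "L1_norm_y (x_average (f t)) \<le> L1_norm_y (x_average (f s))" if "0 < s" "s \<le> t" for s
    unfolding L1_norm_y_def
  proof (rule heat_L1_contraction[where hy = "\<lambda>s. x_average (Dy (f s))"
        and hyy = "\<lambda>s. x_average (Dy (Dy (f s)))" and \<nu> = \<nu>])
    fix s y :: real assume s: "0 < s"
    have C1: "C1 (f s)" "C1 (Dy (f s))" and per: "periodic2 (f s)"
      using C2[OF s] by (simp_all add: C2_torus_def)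
    have "((\<lambda>s. x_average (f s) y) has_real_derivative x_average (Dt f s) y) (at s)"
      using C12_torus_has_time_derivative[OF C12_torus_x_average(1)[OF C12] s]
        C12_torus_x_average(2)[OF C12 s] by simp
    then show "((\<lambda>s. x_average (f s) y) has_real_derivative \<nu> * x_average (Dy (Dy (f s))) y) (at s)"
      using x_average_shear_equation[OF f s] by (simp add: x_average_def)
    show "(x_average (f s) has_real_derivative x_average (Dy (f s)) y) (at y)"
      "(x_average (Dy (f s)) has_real_derivative x_average (Dy (Dy (f s))) y) (at y)"
      using C1_has_derivative(2)[OF C1_x_average(1)[OF C1(1)]]
        C1_has_derivative(2)[OF C1_x_average(1)[OF C1(2)]] C1 by (simp_all add: C1_x_average)
    show "x_average (f s) (y + 1) = x_average (f s) y"
      "x_average (Dy (f s)) (y + 1) = x_average (Dy (f s)) y"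
      using per by (simp_all add: x_average_def Dy_periodic[OF C1(1) per]) (simp add: periodic2_def)
  next
    show "continuous_on ({0<..} \<times> UNIV) (\<lambda>(s, y). x_average (f s) y)"
      "continuous_on ({0<..} \<times> UNIV) (\<lambda>(s, y). x_average (Dy (Dy (f s))) y)"
      using C12 by (auto intro!: continuous_on_x_average_pos_time simp: C12_torus_def)
  qed (use assms that in auto)
  have L1: "L1_norm (\<lambda>x. x_average (f s)) = L1_norm_y (x_average (f s))" if "0 \<le> s" for s
    using that shear_solution_continuous[OF f, of s] f0
    by (cases "s = 0") (auto intro!: L1_norm_function_of_y continuous_x_average)
  have lim: "((\<lambda>s. L1_norm (\<lambda>x. x_average (f s))) \<longlongrightarrow> L1_norm (\<lambda>x. x_average (f 0))) (at_right 0)"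
    by (rule shear_solution_L1_tendsto[OF shear_solution_x_average[OF f f0]])
  have "eventually (\<lambda>s. L1_norm_y (x_average (f t)) \<le> L1_norm (\<lambda>x. x_average (f s))) (at_right 0)"
    using mono t by (auto simp: eventually_at_right_field L1 intro: exI[of _ t])
  from tendsto_lowerbound[OF lim this] show ?thesis
    by (simp add: L1)
qed

section \<open>Reaction and mass loss\<close>

text \<open>The product dominates the square of the minimum, and Jensen's inequality bounds the
  integral of that square below by the square of the integral. Integrating
  \<open>2 * min a b = a + b - \<bar>a - b\<bar>\<close> shows that the integral of the minimum is
  at least \<open>m\<close>.\<close>

lemma integral_product_lower_bound:
  assumes g: "continuous_on UNIV (case_prod g)" and h: "continuous_on UNIV (case_prod h)"
    and nonneg: "\<And>x y. 0 \<le> g x y" "\<And>x y. 0 \<le> h x y"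
    and "0 \<le> m" and m: "2 * m \<le> L1_norm g + L1_norm h - L1_norm (\<lambda>x y. g x y - h x y)"
  shows "m\<^sup>2 \<le> (LINT (x, y)|torus2. g x y * h x y)"
proof -
  define G H where "G = case_prod g" and "H = case_prod h"
  have GH: "continuous_on UNIV G" "continuous_on UNIV H"
    using g h by (simp_all add: G_def H_def)
  have int: "integrable torus2 k" if "continuous_on UNIV k" for k :: "real \<times> real \<Rightarrow> real"
    using integrable_torus2[of "curry k"] that by simp
  have cmin: "continuous_on UNIV (\<lambda>p. min (G p) (H p))"
    using GH by (intro continuous_intros)
  have "2 * min (G p) (H p) = \<bar>G p\<bar> + \<bar>H p\<bar> - \<bar>G p - H p\<bar>" for p
    using nonneg by (auto simp: min_def abs_if G_def H_def case_prod_unfold not_less[symmetric])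
  then have "2 * (LINT p|torus2. min (G p) (H p)) = (LINT p|torus2. \<bar>G p\<bar> + \<bar>H p\<bar> - \<bar>G p - H p\<bar>)"
    by (simp flip: Bochner_Integration.integral_mult_right_zero)
  also have "\<dots> = L1_norm g + L1_norm h - L1_norm (\<lambda>x y. g x y - h x y)"
    using GH by (simp add: L1_norm_def case_prod_unfold G_def H_def int continuous_intros)
  finally have "m \<le> (LINT p|torus2. min (G p) (H p))"
    using m by simp
  then have "m\<^sup>2 \<le> (LINT p|torus2. min (G p) (H p))\<^sup>2"
    using \<open>0 \<le> m\<close> by (rule power_mono)
  also have "\<dots> \<le> (LINT p|torus2. (min (G p) (H p))\<^sup>2)"
    using int[OF cmin] int[OF continuous_on_power[OF cmin, of 2]]
    by (intro square_integral_le(2)[OF torus2.finite_measure_axioms measure_torus2]) auto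
  also have "\<dots> \<le> (LINT p|torus2. G p * H p)"
  proof (rule integral_mono)
    show "(min (G p) (H p))\<^sup>2 \<le> G p * H p" for p
      using nonneg by (auto simp: G_def H_def case_prod_unfold power2_eq_square intro!: mult_mono)
  qed (intro int continuous_intros GH cmin)+
  finally show ?thesis
    by (simp add: G_def H_def case_prod_unfold)
qed

text \<open>The difference splits into its average, controlled by heat contraction in L1, and its
  fluctuation, controlled in L2 by \<open>decay\<close>. The latter is stated at the single time
  \<open>t\<close> with a bare factor \<open>D\<close>, so that the decay rate enters only when
  \<open>D\<close> is chosen.\<close>

lemma difference_L1_bound:
  assumes sol1: "shear_solution u \<nu> F n1" and sol2: "shear_solution u \<nu> F n2"
    and cont0: "continuous_on UNIV (case_prod (n1 0))" "continuous_on UNIV (case_prod (n2 0))"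
    and nonneg: "\<And>t x y. 0 \<le> t \<Longrightarrow> 0 \<le> n1 t x y" "\<And>t x y. 0 \<le> t \<Longrightarrow> 0 \<le> n2 t x y"
    and decay: "\<And>f. shear_solution u \<nu> (\<lambda>t x y. 0) f \<Longrightarrow> (\<forall>y. x_average (f 0) y = 0) \<Longrightarrow>
      L2_norm (f t) \<le> D * L2_norm (f 0)"
    and "0 \<le> D" "0 \<le> \<nu>" "0 < t"
  shows "L1_norm (\<lambda>x y. n1 t x y - n2 t x y) \<le>
    L1_norm_y (x_average (\<lambda>x y. n1 0 x y - n2 0 x y)) + D * (L2_norm (n1 0) + L2_norm (n2 0))"
proof -
  define w where "w = (\<lambda>t x y. n1 t x y - n2 t x y)"
  define v where "v = (\<lambda>t x y. w t x y - x_average (w t) y)"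
  have w: "shear_solution u \<nu> (\<lambda>t x y. 0) w"
    using shear_solution_diff[OF sol1 sol2] by (simp add: w_def)
  have w0: "continuous_on UNIV (case_prod (w 0))"
    using cont0 by (auto simp: w_def case_prod_unfold intro!: continuous_on_diff)
  have wt: "continuous_on UNIV (case_prod (w t))"
    using w \<open>0 < t\<close> by (rule shear_solution_continuous)
  \<comment> \<open>The fluctuation is the difference of two unforced solutions, namely
    \<open>w\<close> and its average.\<close>
  have v: "shear_solution u \<nu> (\<lambda>t x y. 0) v"
    using shear_solution_diff[OF w shear_solution_x_average[OF w w0]]
    by (simp add: v_def x_average_def)
  have "x_average (v 0) y = 0" for y
    using x_average_diff[OF w0 continuous_x_average_plane[OF w0], of y]
    by (simp add: v_def) (simp add: x_average_def)
  then have "L2_norm (v t) \<le> D * L2_norm (v 0)"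
    using decay[OF v] by blast
  also have "\<dots> \<le> D * L2_norm (w 0)"
    using L2_norm_x_average(2)[OF w0] \<open>0 \<le> D\<close> by (simp add: v_def mult_left_mono)
  also have "\<dots> \<le> D * (L2_norm (n1 0) + L2_norm (n2 0))"
    using L2_norm_diff_nonneg_le[OF in_L2_continuous in_L2_continuous, OF cont0] nonneg \<open>0 \<le> D\<close>
    by (simp add: w_def mult_left_mono)
  finally have "L1_norm (v t) \<le> D * (L2_norm (n1 0) + L2_norm (n2 0))"
    using L1_norm_le_L2_norm[OF shear_solution_in_L2[OF v, of t]] \<open>0 < t\<close> by simp
  moreover have "L1_norm (w t) \<le> L1_norm_y (x_average (w t)) + L1_norm (v t)"
    using L1_norm_triangle[OF integrable_torus2[OF wt]
        integrable_torus2[OF continuous_x_average_plane[OF wt]]]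
      L1_norm_function_of_y[OF continuous_x_average[OF wt]]
    by (simp add: v_def)
  moreover have "L1_norm_y (x_average (w t)) \<le> L1_norm_y (x_average (w 0))"
    using shear_solution_x_average_L1_contraction[OF w w0] assms by blast
  ultimately show ?thesis
    by (simp add: w_def)
qed

text \<open>From time \<open>T0\<close> on the two species overlap enough for a reaction rate of
  order \<open>\<epsilon> * M\<^sup>2\<close>, and \<open>T1\<close> is long enough for this rate to
  consume a fixed fraction of \<open>M\<close>, the minimum norm of the initial averages.\<close>

lemma reaction_mass_loss:
  assumes sol1: "shear_solution u \<nu> (\<lambda>t x y. - \<epsilon> * n1 t x y * n2 t x y) n1"
    and sol2: "shear_solution u \<nu> (\<lambda>t x y. - \<epsilon> * n1 t x y * n2 t x y) n2"
    and nonneg: "\<And>t x y. 0 \<le> t \<Longrightarrow> 0 \<le> n1 t x y" "\<And>t x y. 0 \<le> t \<Longrightarrow> 0 \<le> n2 t x y"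
    and cont0: "continuous_on UNIV (case_prod (n1 0))" "continuous_on UNIV (case_prod (n2 0))"
    and small: "\<And>t. T0 \<le> t \<Longrightarrow> 0 < t \<Longrightarrow> L1_norm (\<lambda>x y. n1 t x y - n2 t x y) \<le>
      L1_norm_y (x_average (\<lambda>x y. n1 0 x y - n2 0 x y)) + min_average_norm (n1 0) (n2 0) / 2"
    and M: "0 < min_average_norm (n1 0) (n2 0)" and "0 < \<epsilon>" "0 \<le> T0" "0 < T1"
    and T1: "1 \<le> \<epsilon> * T1 * min_average_norm (n1 0) (n2 0)"
  shows "min_average_norm (n1 0) (n2 0) / 12 \<le> L1_norm (n1 0) - L1_norm (n1 (T0 + T1))"
proof -
  define M where "M = min_average_norm (n1 0) (n2 0)"
  define P where "P = (\<lambda>t. LINT (x, y)|torus2. n1 t x y * n2 t x y)"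
  define a b where "a = (\<lambda>t. L1_norm (n1 t))" and "b = (\<lambda>t. L1_norm (n2 t))"
  note cont = shear_solution_continuous[OF sol1] shear_solution_continuous[OF sol2]
  have "continuous_on UNIV (case_prod (\<lambda>x y. - \<epsilon> * n1 t x y * n2 t x y))" if "0 < t" for t
    using cont[OF that] by (auto simp: case_prod_unfold intro!: continuous_intros)
  note deriv = shear_solution_L1_derivative[OF sol1 _ _ this] shear_solution_L1_derivative[OF sol2 _ _ this]
  have rate: "(LINT (x, y)|torus2. - \<epsilon> * n1 t x y * n2 t x y) = - \<epsilon> * P t" for t
    unfolding P_def case_prod_unfold by (simp add: mult.assoc)
  have da: "(a has_real_derivative - \<epsilon> * P t) (at t)"
    and db: "(b has_real_derivative - \<epsilon> * P t) (at t)" if "0 < t" for t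
    using deriv[OF that] that nonneg less_imp_le unfolding a_def b_def rate by blast+
  have P: "0 \<le> P t" if "0 \<le> t" for t
    using nonneg that by (auto simp: P_def case_prod_unfold)
  have lim: "(a \<longlongrightarrow> a 0) (at_right 0)" "(b \<longlongrightarrow> b 0) (at_right 0)"
    using shear_solution_L1_tendsto[OF sol1] shear_solution_L1_tendsto[OF sol2]
    by (simp_all add: a_def b_def)
  have mono: "a t \<le> a s" if "0 < s" "s \<le> t" for s t
  proof (rule DERIV_nonpos_imp_nonincreasing[OF that(2)])
    show "\<exists>y. (a has_real_derivative y) (at r) \<and> y \<le> 0" if "s \<le> r" for r
      using da[of r] P[of r] that \<open>0 < s\<close> \<open>0 < \<epsilon>\<close> by (intro exI[of _ "- \<epsilon> * P r"]) auto
  qed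
  \<comment> \<open>The mass is differentiated only at positive times, so time 0 is reached as a
    right limit.\<close>
  have le0: "a t \<le> a 0" if "0 < t" for t
  proof (rule tendsto_lowerbound[OF lim(1)])
    show "eventually (\<lambda>s. a t \<le> a s) (at_right 0)"
      using mono that by (auto simp: eventually_at_right_field intro: exI[of _ t])
  qed simp
  \<comment> \<open>Both masses have the same derivative, so their difference is constant for
    positive times; its limit at 0 identifies the constant.\<close>
  have same: "a t - b t = a 0 - b 0" if t: "0 < t" for t
  proof -
    have "((\<lambda>s. a s - b s) has_real_derivative 0) (at r within {0<..})" if "r \<in> {0<..}" for r
      using DERIV_diff[OF da db, of r] that by (auto intro: has_field_derivative_at_within)
    then obtain c where c: "\<And>s. 0 < s \<Longrightarrow> a s - b s = c"
      using has_field_derivative_zero_constant[of "{0<..}" "\<lambda>s. a s - b s"] by fastforce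
    have "((\<lambda>s. a s - b s) \<longlongrightarrow> a 0 - b 0) (at_right 0)"
      using lim by (rule tendsto_diff)
    moreover have "((\<lambda>s. a s - b s) \<longlongrightarrow> c) (at_right 0)"
      by (rule tendsto_eventually) (auto simp: eventually_at_right_field c intro: exI[of _ 1])
    ultimately show ?thesis
      using c[OF t] tendsto_unique[of "at_right (0::real)"] by fastforce
  qed
  have M0: "2 * M = a 0 + b 0 - L1_norm_y (x_average (\<lambda>x y. n1 0 x y - n2 0 x y))"
    unfolding M_def a_def b_def using cont0 nonneg by (intro min_average_norm_eq) auto
  show ?thesis
  proof (rule ccontr)
    assume "\<not> ?thesis"
    then have loss: "a 0 - a (T0 + T1) < M / 12"
      by (simp add: M_def a_def)
    have "0 < M"
      using M by (simp add: M_def)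
    have P_lower: "(M / 2)\<^sup>2 \<le> P t" if t: "T0 \<le> t" "0 < t" "t \<le> T0 + T1" for t
      unfolding P_def
    proof (rule integral_product_lower_bound)
      \<comment> \<open>Each mass at time \<open>t\<close> is within \<open>M / 12\<close> of its
        initial value. With \<open>M0\<close> and \<open>small\<close> the right side is at least
        \<open>2 * M - M / 6 - M / 2\<close>, which is \<open>4 * M / 3\<close>.\<close>
      show "2 * (M / 2) \<le> L1_norm (n1 t) + L1_norm (n2 t) - L1_norm (\<lambda>x y. n1 t x y - n2 t x y)"
        using small[OF t(1,2)] M0 same[OF t(2)] mono[OF t(2,3)] loss \<open>0 < M\<close>
        unfolding M_def[symmetric] a_def b_def by argo
    qed (use cont[OF t(2)] nonneg t \<open>0 < M\<close> in auto)
    \<comment> \<open>Starting halfway keeps the mean value theorem within positive times even if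
      \<open>T0 = 0\<close>. Half of the interval still forces a loss of \<open>M / 8\<close>, more
      than the assumed \<open>M / 12\<close>.\<close>
    define s where "s = T0 + T1 / 2"
    have s: "T0 \<le> s" "0 < s" "s < T0 + T1" "T0 + T1 - s = T1 / 2"
      using \<open>0 \<le> T0\<close> \<open>0 < T1\<close> by (simp_all add: s_def)
    obtain z where z: "s < z" "z < T0 + T1"
      "a (T0 + T1) - a s = (T0 + T1 - s) * (- \<epsilon> * P z)"
      using MVT2[OF s(3), of a "\<lambda>t. - \<epsilon> * P t"] da s(2) by fastforce
    have "M * 1 \<le> M * (\<epsilon> * T1 * M)"
      using T1 \<open>0 < M\<close> by (intro mult_left_mono) (simp_all add: M_def)
    then have "M / 8 \<le> T1 / 2 * (\<epsilon> * (M / 2)\<^sup>2)"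
      by (simp add: power2_eq_square algebra_simps)
    also have "\<dots> \<le> T1 / 2 * (\<epsilon> * P z)"
      using P_lower[of z] z s \<open>0 < T1\<close> \<open>0 < \<epsilon>\<close> by (intro mult_left_mono) auto
    also have "\<dots> = a s - a (T0 + T1)"
      using z(3) unfolding s(4) by simp
    finally show False
      using le0[OF s(2)] loss \<open>0 < M\<close> by simp
  qed
qed

section \<open>Choice of the constants and conclusion\<close>

theorem theorem1p3:
  fixes u d :: "real \<Rightarrow> real" and \<delta> \<nu>\<^sub>0 :: real
  assumes "continuous_on UNIV u" and "\<And>y. u (y + 1) = u y"
    and "relaxation_enhancing u d \<delta> \<nu>\<^sub>0"
  shows "\<exists>C\<ge>1. \<forall>(\<nu>::real) (\<epsilon>::real) (n1 :: real \<Rightarrow> real \<Rightarrow> real \<Rightarrow> real) (n2 :: real \<Rightarrow> real \<Rightarrow> real \<Rightarrow> real).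
    0 < \<nu> \<longrightarrow> \<nu> \<le> \<nu>\<^sub>0 \<longrightarrow> \<nu> \<le> 1 \<longrightarrow> 0 < \<epsilon> \<longrightarrow> \<epsilon> \<le> 1 \<longrightarrow>
    shear_solution u \<nu> (\<lambda>t x y. - \<epsilon> * n1 t x y * n2 t x y) n1 \<longrightarrow>
    shear_solution u \<nu> (\<lambda>t x y. - \<epsilon> * n1 t x y * n2 t x y) n2 \<longrightarrow>
    (\<forall>t\<ge>0. \<forall>x y. 0 \<le> n1 t x y \<and> 0 \<le> n2 t x y) \<longrightarrow>
    C2_torus (n1 0) \<longrightarrow> C2_torus (n2 0) \<longrightarrow>
    L1_norm (n1 0) \<le> L1_norm (n2 0) \<longrightarrow>
    min_average_norm (n1 0) (n2 0) \<noteq> 0 \<longrightarrow>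
    (let M = min_average_norm (n1 0) (n2 0);
         S = L2_norm (n1 0) + L2_norm (n2 0);
         T0 = 1 / (\<delta> * d \<nu>) * ln (C * (\<epsilon> / (\<delta> * d \<nu>) * S + 1) * (S / M));
         T1 = C / \<epsilon> * max 1 (1 / M)
     in L1_norm (n1 0) - L1_norm (n1 (T0 + T1)) \<ge> 1 / 12 * M)"
proof -
  obtain K where K: "\<And>\<nu> f t. \<nu> \<in> {0<..\<nu>\<^sub>0} \<Longrightarrow> shear_solution u \<nu> (\<lambda>t x y. 0) f \<Longrightarrow>
      (\<forall>y. x_average (f 0) y = 0) \<Longrightarrow> 0 \<le> t \<Longrightarrow>
      L2_norm (f t) \<le> K * L2_norm (f 0) * exp (- \<delta> * d \<nu> * t)"
    using assms(3) unfolding relaxation_enhancing_def by blast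
  \<comment> \<open>The sign of \<open>K\<close> is unknown, hence the maximum with 1, which also
    makes the argument of the logarithm at least 1. The factor 2 produces the bound
    \<open>M / (2 * S)\<close> on \<open>K * exp (- r * t)\<close> for times after
    \<open>T0\<close>.\<close>
  define C where "C = max 1 (2 * K)"
  have C: "1 \<le> C" "2 * K \<le> C"
    by (simp_all add: C_def)
  show ?thesis
  proof (intro exI[of _ C] conjI C(1) allI impI, goal_cases)
    case (1 \<nu> \<epsilon> n1 n2)
    note sol = 1(6,7)
    have nonneg: "\<And>t x y. 0 \<le> t \<Longrightarrow> 0 \<le> n1 t x y" "\<And>t x y. 0 \<le> t \<Longrightarrow> 0 \<le> n2 t x y"
      using 1(8) by auto
    have cont0: "continuous_on UNIV (case_prod (n1 0))" "continuous_on UNIV (case_prod (n2 0))"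
      using 1(9,10) by (simp_all add: C2_torus_def C1_continuous)
    define M where "M = min_average_norm (n1 0) (n2 0)"
    define S where "S = L2_norm (n1 0) + L2_norm (n2 0)"
    define r where "r = \<delta> * d \<nu>"
    define L where "L = C * (\<epsilon> / r * S + 1) * (S / M)"
    define T0 where "T0 = 1 / r * ln L"
    define T1 where "T1 = C / \<epsilon> * max 1 (1 / M)"
    have "0 < r"
      using assms(3) 1(1,2) by (simp add: relaxation_enhancing_def r_def)
    have "0 \<le> M"
      by (simp add: M_def min_average_norm_def L1_norm_y_def)
    with 1(12) have "0 < M"
      by (simp add: M_def)
    \<comment> \<open>This leads to \<open>M \<le> S\<close>, so that \<open>S / M\<close> is at
      least 1 and the waiting time \<open>T0\<close> is nonnegative.\<close>
    have "2 * M \<le> L1_norm (n1 0) + L1_norm (n2 0)"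
      using min_average_norm_eq[OF cont0] nonneg by (simp add: M_def L1_norm_y_def)
    moreover have "L1_norm (n1 0) \<le> L2_norm (n1 0)" "L1_norm (n2 0) \<le> L2_norm (n2 0)"
      using cont0 by (auto intro: L1_norm_le_L2_norm in_L2_continuous)
    ultimately have "M \<le> S"
      using \<open>0 < M\<close> by (simp add: S_def)
    have factor: "1 \<le> \<epsilon> / r * S + 1"
      using \<open>0 < r\<close> \<open>0 < \<epsilon>\<close> \<open>M \<le> S\<close> \<open>0 < M\<close> by simp
    \<comment> \<open>A lower bound for \<open>L\<close> is what makes
      \<open>exp (- r * T0)\<close>, which equals \<open>1 / L\<close>, small enough.\<close>
    have L_ge: "C * (S / M) \<le> L"
    proof -
      have "C * 1 * (S / M) \<le> L"
        unfolding L_def using factor C \<open>M \<le> S\<close> \<open>0 < M\<close> by (intro mult_mono) auto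
      then show ?thesis by simp
    qed
    have "1 * 1 \<le> C * (S / M)"
      using C \<open>M \<le> S\<close> \<open>0 < M\<close> by (intro mult_mono) auto
    with L_ge have "1 \<le> L"
      by simp
    then have "0 \<le> T0"
      using \<open>0 < r\<close> by (simp add: T0_def)
    have "C / \<epsilon> * (1 / M) \<le> T1"
      unfolding T1_def using C \<open>0 < \<epsilon>\<close> by (intro mult_left_mono) auto
    then have T1_ge: "C \<le> \<epsilon> * T1 * M"
      using \<open>0 < M\<close> \<open>0 < \<epsilon>\<close> by (simp add: field_simps)
    have "0 < T1"
      using C \<open>0 < \<epsilon>\<close> by (simp add: T1_def)
    define D where "D = M / (2 * S)"
    have D: "0 \<le> D" "D * S = M / 2"
      using \<open>0 < M\<close> \<open>M \<le> S\<close> by (simp_all add: D_def)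
    have decay: "L2_norm (f t) \<le> D * L2_norm (f 0)"
      if f: "shear_solution u \<nu> (\<lambda>t x y. 0) f" "\<forall>y. x_average (f 0) y = 0" and t: "T0 \<le> t" for f t
    proof -
      \<comment> \<open>Waiting until \<open>T0\<close> makes the exponential at most
        \<open>1 / L\<close>, hence at most \<open>M / (C * S)\<close>; the choice of
        \<open>C\<close> then absorbs \<open>K\<close>.\<close>
      have "ln L \<le> r * t"
        using t \<open>0 < r\<close> by (simp add: T0_def field_simps)
      then have "exp (- r * t) \<le> exp (- ln L)"
        by simp
      also have "\<dots> = 1 / L"
        using \<open>1 \<le> L\<close> by (simp add: exp_minus inverse_eq_divide)
      also have "\<dots> \<le> 1 / (C * (S / M))"
        using L_ge \<open>1 \<le> L\<close> C \<open>M \<le> S\<close> \<open>0 < M\<close>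
        by (intro divide_left_mono mult_pos_pos divide_pos_pos) auto
      finally have "C * exp (- r * t) \<le> 2 * D"
        using C \<open>M \<le> S\<close> \<open>0 < M\<close> by (simp add: D_def field_simps)
      moreover have "2 * K * exp (- r * t) \<le> C * exp (- r * t)"
        using C(2) by (rule mult_right_mono) simp
      ultimately have "K * exp (- r * t) \<le> D"
        by linarith
      then have "K * exp (- r * t) * L2_norm (f 0) \<le> D * L2_norm (f 0)"
        by (rule mult_right_mono) simp
      then show ?thesis
        using K[OF _ f, of t] 1(1,2) t \<open>0 \<le> T0\<close> by (simp add: r_def mult_ac)
    qed
    have "M / 12 \<le> L1_norm (n1 0) - L1_norm (n1 (T0 + T1))"
      unfolding M_def
    proof (rule reaction_mass_loss[OF sol nonneg cont0])
      show "L1_norm (\<lambda>x y. n1 t x y - n2 t x y) \<le>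
          L1_norm_y (x_average (\<lambda>x y. n1 0 x y - n2 0 x y)) + min_average_norm (n1 0) (n2 0) / 2"
        if t: "T0 \<le> t" "0 < t" for t
        \<comment> \<open>The error \<open>M / 2\<close> is rewritten as \<open>D * S\<close>, the
          form in which \<open>difference_L1_bound\<close> delivers it.\<close>
        unfolding S_def[symmetric] M_def[symmetric] D(2)[symmetric] unfolding S_def
        by (rule difference_L1_bound[OF sol cont0 nonneg decay[OF _ _ t(1)] D(1) less_imp_le[OF 1(1)] t(2)];
            assumption)
    qed (use \<open>0 < M\<close> \<open>0 < \<epsilon>\<close> \<open>0 \<le> T0\<close> \<open>0 < T1\<close> T1_ge C in \<open>auto simp: M_def\<close>)
    then show ?case
      unfolding Let_def M_def[symmetric] S_def[symmetric] r_def[symmetric] L_def[symmetric]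
        T0_def[symmetric] T1_def[symmetric] by simp
  qed
qed

end
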